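(* There is an absolute constant $K$ such that the following holds. Let $C \subseteq \{0,1\}^m$ be a code with $\mathrm{CL}(C) \ge 1$, let $w : [m] \to \mathbb{R}_{\ge 0}$ be weights, and let $\epsilon \in (0,1)$. Then there exists a $(1\pm\epsilon)$-sparsifier $\widetilde w$ of $C$ with respect to $w$ such that \[ |\operatorname{supp}(\widetilde w)| \le K\cdot \frac{\mathrm{CL}(C)\cdot \log^2(\mathrm{CL}(C)/\epsilon)\cdot \big(\log\log(\mathrm{CL}(C)/\epsilon)\big)^2}{\epsilon^2}. \]
   Context: A code is a subset $C \subseteq \{0,1\}^m$, where $[m]=\{1,\dots,m\}$ is the set of coordinates (equivalently, $C$ encodes a set system $\mathcal S \subseteq 2^{[m]}$ via indicator vectors). A chain of length $\ell$ in $C$ is a pair of injective maps $a:[\ell]\to[m]$ and $c:[\ell]\to C$ such that $c(i)_{a(i)} = 1$ for all $i\in[\ell]$, and $c(i)_{a(j)} = 0$ for all $1\le i<j\le \ell$. The chain length $\mathrm{CL}(C)$ is the maximum length of a chain in $C$ (it is $0$ if no chain of length $1$ exists). Given weights $w:[m]\to\mathbb{R}_{\ge 0}$ and $\epsilon>0$, a $(1\pm\epsilon)$-sparsifier of $C$ with respect to $w$ is a function $\widetilde w:[m]\to\mathbb{R}_{\ge0}$ such that for every $c\in C$, $(1-\epsilon)\sum_i w(i)c_i \le \sum_i \widetilde w(i) c_i \le (1+\epsilon)\sum_i w(i)c_i$. Here $\operatorname{supp}(\widetilde w)=\{i : \widetilde w(i)\neq 0\}$ (the set of retained coordinates). Logarithms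 are understood to be at least $1$, i.e. $\log x := \max\{\log_2 x, 1\}$. *)

theory Defs
  imports Complex_Main
begin

text \<open>Coordinates are [m] = {1..m}. A word in {0,1}^m is encoded by its support,
  a set c \<subseteq> {1..m} (c_i = 1 iff i \<in> c). A code is a set of such sets.\<close>

definition is_code :: "nat \<Rightarrow> nat set set \<Rightarrow> bool" where
  "is_code m C \<longleftrightarrow> (\<forall>c\<in>C. c \<subseteq> {1..m})"

definition is_chain :: "nat \<Rightarrow> nat set set \<Rightarrow> nat \<Rightarrow> (nat \<Rightarrow> nat) \<Rightarrow> (nat \<Rightarrow> nat set) \<Rightarrow> bool" where
  "is_chain m C l a c \<longleftrightarrow>
     inj_on a {1..l} \<and> a ` {1..l} \<subseteq> {1..m} \<and>
     inj_on c {1..l} \<and> c ` {1..l} \<subseteq> C \<and>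
     (\<forall>i\<in>{1..l}. a i \<in> c i) \<and>
     (\<forall>i\<in>{1..l}. \<forall>j\<in>{1..l}. i < j \<longrightarrow> a j \<notin> c i)"

definition has_chain :: "nat \<Rightarrow> nat set set \<Rightarrow> nat \<Rightarrow> bool" where
  "has_chain m C l \<longleftrightarrow> (\<exists>a c. is_chain m C l a c)"

text \<open>Chain length: maximum length of a chain (0 if none of length 1; the empty
  chain of length 0 always exists). Lengths are bounded by m by injectivity of a.\<close>
definition chain_length :: "nat \<Rightarrow> nat set set \<Rightarrow> nat" where
  "chain_length m C = Max {l. has_chain m C l}"

definition code_weight :: "(nat \<Rightarrow> real) \<Rightarrow> nat set \<Rightarrow> real" where
  "code_weight w c = (\<Sum>i\<in>c. w i)"

definition is_sparsifier :: "nat \<Rightarrow> nat set set \<Rightarrow> (nat \<Rightarrow> real) \<Rightarrow> real \<Rightarrow> (nat \<Rightarrow> real) \<Rightarrow> bool" where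
  "is_sparsifier m C w \<epsilon> w' \<longleftrightarrow>
     (\<forall>i\<in>{1..m}. w' i \<ge> 0) \<and>
     (\<forall>c\<in>C. (1 - \<epsilon>) * code_weight w c \<le> code_weight w' c \<and>
             code_weight w' c \<le> (1 + \<epsilon>) * code_weight w c)"

definition supp_m :: "nat \<Rightarrow> (nat \<Rightarrow> real) \<Rightarrow> nat set" where
  "supp_m m w' = {i\<in>{1..m}. w' i \<noteq> 0}"

definition lg :: "real \<Rightarrow> real" where
  "lg x = max (log 2 x) 1"

end

theory Submission
  imports Defs "HOL-Analysis.Convex"
begin

text \<open>Let r(D) be the chain length of D. Concatenating chains gives
  r({c \<in> D. c \<subseteq> U}) + r({c - U | c \<in> D}) \<le> r(D), and forbidding a coordinate that occurs in
  some codeword lowers r by at least one.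

  Counting: if every restriction to a set V satisfies w(V) \<ge> d r, then, as in Karger's contraction
  algorithm, few codewords have weight at most \<lambda> d. In generating function form, delete coordinate i
  at rate w(i): the rank r then dies at rate at least d r, so it is dominated by r independent
  exponential clocks of rate d.

  Halving: for each scale d = 4^t, maximising d r - w over an increasing sequence of sets U t leaves a
  code on the complement of U t with the density property, while U (t + 1) - U t has weight at most
  4 d times its share of r. So at most half of the N coordinates are too heavy for their scale; the
  others have their weight doubled or deleted according to signs chosen by the exponential moment
  method. The counting bound pays for all codewords at each scale, and only about log r
  scales matter for a given codeword, so one step has relative error of order
  sqrt (r log r log N / N).

  Iterating shrinks the support geometrically; the errors sum to a geometric series dominated by the
  last step.\<close>

section \<open>Rank of a code: restriction, projection, and the number of codewords\<close>

section \<open>Chain length\<close>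

text \<open>Chains are built by their last pair (coordinate i, codeword c): all earlier codewords avoid i,
  and injectivity is then automatic.\<close>

inductive chain_in :: "'a set set \<Rightarrow> nat \<Rightarrow> bool" where
  chain_in_0: "chain_in D 0"
| chain_in_Suc: "i \<in> c \<Longrightarrow> c \<in> D \<Longrightarrow> chain_in {c \<in> D. i \<notin> c} n \<Longrightarrow> chain_in D (Suc n)"

lemma chain_in_mono: "chain_in D n \<Longrightarrow> D \<subseteq> D' \<Longrightarrow> chain_in D' n"
proof (induction arbitrary: D' rule: chain_in.induct)
  case (chain_in_Suc i c D n)
  have "chain_in {c \<in> D'. i \<notin> c} n" using chain_in_Suc.prems by (intro chain_in_Suc.IH) auto
  then show ?case using chain_in_Suc by (intro chain_in.chain_in_Suc[of i c]) auto
qed (rule chain_in_0)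

lemma chain_in_le_card: "chain_in D n \<Longrightarrow> finite D \<Longrightarrow> n \<le> card D"
proof (induction rule: chain_in.induct)
  case (chain_in_Suc i c D n)
  have "{c \<in> D. i \<notin> c} \<subset> D" using chain_in_Suc by auto
  then have "card {c \<in> D. i \<notin> c} < card D" using chain_in_Suc.prems by (rule psubset_card_mono[rotated])
  then show ?case using chain_in_Suc by auto
qed simp

text \<open>The coordinates of a chain of the projected code lie outside \<open>U\<close>, so
  codewords inside \<open>U\<close> avoid them all and their chain can come first. The induction
  peels off the last pair; filtering by \<open>i \<notin> c\<close> commutes with removing
  \<open>U\<close> because \<open>i \<notin> U\<close>.\<close>

lemma chain_in_append:
  "chain_in ((\<lambda>c. c - U) ` D) b \<Longrightarrow> chain_in {c \<in> D. c \<subseteq> U} a \<Longrightarrow> chain_in D (a + b)"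
proof (induction "(\<lambda>c. c - U) ` D" b arbitrary: D rule: chain_in.induct)
  case chain_in_0
  then show ?case by (auto elim: chain_in_mono)
next
  case (chain_in_Suc i c n)
  obtain c' where c': "c' \<in> D" "c = c' - U" using chain_in_Suc by auto
  have i: "i \<in> c'" "i \<notin> U" using c' chain_in_Suc by auto
  have "chain_in {c \<in> D. i \<notin> c} (a + n)"
  proof (rule chain_in_Suc.hyps(4))
    show "{c \<in> (\<lambda>c. c - U) ` D. i \<notin> c} = (\<lambda>c. c - U) ` {c \<in> D. i \<notin> c}" using i by auto
    have "{c \<in> {c \<in> D. i \<notin> c}. c \<subseteq> U} = {c \<in> D. c \<subseteq> U}" using i by auto
    then show "chain_in {c \<in> {c \<in> D. i \<notin> c}. c \<subseteq> U} a" using chain_in_Suc.prems by simp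
  qed
  then show ?case using chain_in.chain_in_Suc[OF i(1) c'(1)] by simp
qed

definition rk :: "'a set set \<Rightarrow> nat" where
  "rk D = Max {n. chain_in D n}"

lemma finite_chain_lengths: "finite D \<Longrightarrow> finite {n. chain_in D n}"
  by (rule finite_subset[of _ "{..card D}"]) (auto dest: chain_in_le_card)

lemma rk_ge: "finite D \<Longrightarrow> chain_in D n \<Longrightarrow> n \<le> rk D"
  unfolding rk_def by (rule Max_ge) (auto intro: finite_chain_lengths)

lemma chain_in_rk: "finite D \<Longrightarrow> chain_in D (rk D)"
  unfolding rk_def using Max_in[OF finite_chain_lengths, of D] chain_in_0[of D] by auto

text \<open>For linear codes the rank is the dimension and equality holds. In general this
  inequality turns maximality of a set \<open>U\<close> into density of the code projected off
  \<open>U\<close>.\<close>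

lemma rk_superadditive: "finite D \<Longrightarrow> rk {c \<in> D. c \<subseteq> U} + rk ((\<lambda>c. c - U) ` D) \<le> rk D"
  using chain_in_append[of U D] by (simp add: rk_ge chain_in_rk)

lemma rk_contract: "finite D \<Longrightarrow> c \<in> D \<Longrightarrow> i \<in> c \<Longrightarrow> Suc (rk {c \<in> D. i \<notin> c}) \<le> rk D"
  using chain_in_Suc[of i c D] by (simp add: rk_ge chain_in_rk)

lemma rk_mono: "finite D' \<Longrightarrow> D \<subseteq> D' \<Longrightarrow> rk D \<le> rk D'"
  by (meson chain_in_mono chain_in_rk finite_subset rk_ge)

lemma rk_diff_le: "finite D \<Longrightarrow> rk ((\<lambda>c. c - U) ` D) \<le> rk D"
  using rk_superadditive[of D U] by linarith

lemma rk_pos: "finite D \<Longrightarrow> c \<in> D \<Longrightarrow> c \<noteq> {} \<Longrightarrow> 1 \<le> rk D"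
  using rk_contract[of D c] by fastforce

text \<open>A bound of Sauer-Shelah type. If some word contains \<open>x\<close>, the words avoiding
  \<open>x\<close> have smaller rank, while those containing \<open>x\<close> stay distinct without
  it; with \<open>n = Suc (card X)\<close> the recursion is
  \<open>n ^ r + n ^ Suc r = Suc n * n ^ r\<close>.\<close>

lemma card_le_Suc_card_power_rk:
  assumes "finite X" "D \<subseteq> Pow X"
  shows "card D \<le> Suc (card X) ^ rk D"
  using assms
proof (induction X arbitrary: D rule: finite_induct)
  case empty
  then have "D \<subseteq> {{}}" by auto
  then have "card D \<le> 1" using card_mono[of "{{}}" D] by auto
  then show ?case by simp
next
  case (insert x X)
  have fin: "finite D" using insert by (meson finite_Pow_iff finite_insert finite_subset)
  let ?n = "Suc (card X)"
  show ?case
  proof (cases "\<exists>c\<in>D. x \<in> c")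
    case False
    then have "card D \<le> ?n ^ rk D" using insert.prems by (intro insert.IH) auto
    also have "\<dots> \<le> Suc ?n ^ rk D" by (intro power_mono) auto
    finally show ?thesis using insert by simp
  next
    case True
    then obtain c where c: "c \<in> D" "x \<in> c" by auto
    let ?D0 = "{c \<in> D. x \<notin> c}" and ?D1 = "{c \<in> D. x \<in> c}"
    let ?r = "rk D - 1"
    have r: "rk D = Suc ?r" "rk ?D0 \<le> ?r" using rk_contract[OF fin c] by auto
    have "card ?D0 \<le> ?n ^ rk ?D0" using insert.prems by (intro insert.IH) auto
    also have "\<dots> \<le> ?n ^ ?r" using r by (intro power_increasing) auto
    finally have D0: "card ?D0 \<le> ?n ^ ?r" .
    have inj: "inj_on (\<lambda>c. c - {x}) ?D1" by (auto simp: inj_on_def)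
    have "card ?D1 = card ((\<lambda>c. c - {x}) ` ?D1)" by (rule card_image[symmetric, OF inj])
    also have "\<dots> \<le> ?n ^ rk ((\<lambda>c. c - {x}) ` ?D1)"
      using insert.prems by (intro insert.IH) auto
    also have "rk ((\<lambda>c. c - {x}) ` ?D1) \<le> rk ?D1" using fin by (intro rk_diff_le) auto
    also have "rk ?D1 \<le> rk D" using fin by (intro rk_mono) auto
    finally have D1: "card ?D1 \<le> ?n ^ rk D" by (simp add: power_increasing)
    have "D = ?D0 \<union> ?D1" by auto
    then have "card D \<le> card ?D0 + card ?D1" by (metis card_Un_le)
    also have "\<dots> \<le> ?n ^ ?r + ?n ^ Suc ?r" using D0 D1 r(1) by auto
    also have "\<dots> = Suc ?n * ?n ^ ?r" by simp
    also have "\<dots> \<le> Suc ?n * Suc ?n ^ ?r" by (intro mult_left_mono power_mono) auto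
    also have "\<dots> = Suc ?n ^ rk D" by (subst r(1)) simp
    finally show ?thesis using insert by simp
  qed
qed

text \<open>Links the inductive chains to the chains given by maps: the pair added by the inductive
  rule is the last one and gets index \<open>Suc n\<close>.\<close>

lemma rk_le_chain_length:
  assumes "is_code m C"
  shows "rk C \<le> chain_length m C"
proof -
  have C: "finite C" using assms unfolding is_code_def
    by (intro finite_subset[of C "Pow {1..m}"]) auto
  have ex: "has_chain m D n" if "chain_in D n" "is_code m D" for D n
    using that
  proof (induction rule: chain_in.induct)
    case (chain_in_0 D)
    then show ?case by (auto simp: has_chain_def is_chain_def)
  next
    case (chain_in_Suc i c D n)
    have "is_code m {c \<in> D. i \<notin> c}" using chain_in_Suc.prems by (auto simp: is_code_def)
    from chain_in_Suc.IH[OF this] obtain a f where af: "is_chain m {c \<in> D. i \<notin> c} n a f"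
      by (auto simp: has_chain_def)
    have "is_chain m D (Suc n) (a(Suc n := i)) (f(Suc n := c))"
      unfolding is_chain_def
    proof (intro conjI ballI impI)
      have a: "inj_on a {1..n}" "inj_on f {1..n}" "f ` {1..n} \<subseteq> {c \<in> D. i \<notin> c}"
        "a ` {1..n} \<subseteq> {1..m}"
        and b: "\<And>j. j \<in> {1..n} \<Longrightarrow> a j \<in> f j"
        and cc: "\<And>j k. j \<in> {1..n} \<Longrightarrow> k \<in> {1..n} \<Longrightarrow> j < k \<Longrightarrow> a k \<notin> f j"
        using af unfolding is_chain_def by blast+
      have S: "{1..Suc n} = insert (Suc n) {1..n}" by auto
      \<comment> \<open>Earlier codewords contain their own coordinate but avoid \<open>i\<close>,
        whereas \<open>c\<close> contains \<open>i\<close>; this yields injectivity of both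
        maps.\<close>
      have i: "i \<notin> a ` {1..n}" "c \<notin> f ` {1..n}" using a b chain_in_Suc.hyps by blast+
      have upd: "g(Suc n := x) ` {1..n} = g ` {1..n}" for g :: "nat \<Rightarrow> 'b" and x
        by (intro image_cong) auto
      have img: "g(Suc n := x) ` {1..Suc n} = insert x (g ` {1..n})" for g :: "nat \<Rightarrow> 'b" and x
        unfolding S image_insert upd by simp
      have inj: "inj_on (g(Suc n := x)) {1..Suc n}"
        if "x \<notin> g ` {1..n}" "inj_on g {1..n}" for g :: "nat \<Rightarrow> 'b" and x
        unfolding S inj_on_insert using that upd[of g x] inj_on_fun_updI[OF that(2,1), of "Suc n"]
        by auto
      show "inj_on (a(Suc n := i)) {1..Suc n}" "inj_on (f(Suc n := c)) {1..Suc n}"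
        using inj[OF i(1) a(1)] inj[OF i(2) a(2)] .
      show "a(Suc n := i) ` {1..Suc n} \<subseteq> {1..m}"
      proof -
        have "i \<in> {1..m}" using chain_in_Suc.hyps(1,2) chain_in_Suc.prems
          unfolding is_code_def by blast
        then show ?thesis unfolding img using a(4) by blast
      qed
      show "f(Suc n := c) ` {1..Suc n} \<subseteq> D"
        unfolding img using a(3) chain_in_Suc.hyps(2) by blast
      show "(a(Suc n := i)) j \<in> (f(Suc n := c)) j" if "j \<in> {1..Suc n}" for j
        using that b[of j] chain_in_Suc.hyps(1) by (cases "j = Suc n") auto
      show "(a(Suc n := i)) k \<notin> (f(Suc n := c)) j"
        if jk: "j \<in> {1..Suc n}" "k \<in> {1..Suc n}" "j < k" for j k
      proof -
        have j: "j \<in> {1..n}" "j \<noteq> Suc n" using jk by auto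
        have "f j \<in> {c \<in> D. i \<notin> c}" using a(3) j(1) by blast
        then show ?thesis using cc[OF j(1), of k] jk j by (cases "k = Suc n") auto
      qed
    qed
    then show ?case by (auto simp: has_chain_def)
  qed
  \<comment> \<open>Bounded lengths make the set of lengths finite, so that its \<open>Max\<close>
    is an upper bound.\<close>
  have "l \<le> m" if "has_chain m C l" for l
  proof -
    obtain a f where "is_chain m C l a f" using \<open>has_chain m C l\<close> by (auto simp: has_chain_def)
    then have "card {1..l} \<le> card {1..m}" unfolding is_chain_def
      by (intro card_inj_on_le[of a]) auto
    then show ?thesis by simp
  qed
  then have "{l. has_chain m C l} \<subseteq> {..m}" by auto
  then have "finite {l. has_chain m C l}" by (rule finite_subset) simp
  then show ?thesis unfolding chain_length_def
    using ex[OF chain_in_rk[OF C] assms] by (intro Max_ge) auto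
qed

section \<open>The exponential generating function of codeword weights under a density
  condition\<close>

section \<open>Counting light codewords\<close>

text \<open>Double counting: \<open>c\<close> is counted by the coordinates of \<open>U - c\<close>.
  For \<open>h c = exp (- b * sum w c)\<close> the part with \<open>sum w c\<close> is minus the
  derivative of the generating function in \<open>b\<close>.\<close>

lemma sum_weight_sum_avoiding:
  fixes w :: "'a \<Rightarrow> real"
  assumes "finite D" "finite U" "\<And>c. c \<in> D \<Longrightarrow> c \<subseteq> U"
  shows "(\<Sum>i\<in>U. w i * (\<Sum>c\<in>{c \<in> D. i \<notin> c}. h c)) = (\<Sum>c\<in>D. (sum w U - sum w c) * h c)"
proof -
  have "(\<Sum>i\<in>U. w i * (\<Sum>c\<in>{c \<in> D. i \<notin> c}. h c))
    = (\<Sum>i\<in>U. \<Sum>c\<in>D. if i \<notin> c then w i * h c else 0)"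
    using assms by (intro sum.cong refl) (simp add: sum.inter_filter[symmetric] sum_distrib_left)
  also have "\<dots> = (\<Sum>c\<in>D. \<Sum>i\<in>U. if i \<notin> c then w i * h c else 0)"
    by (rule sum.swap)
  also have "\<dots> = (\<Sum>c\<in>D. (sum w U - sum w c) * h c)"
  proof (rule sum.cong)
    fix c assume c: "c \<in> D"
    have "(\<Sum>i\<in>U. if i \<notin> c then w i * h c else 0) = (\<Sum>i\<in>U - c. w i * h c)"
      using assms(2) by (simp add: sum.inter_filter[symmetric] set_diff_eq)
    then show "(\<Sum>i\<in>U. if i \<notin> c then w i * h c else 0) = (sum w U - sum w c) * h c"
      using sum_diff[OF assms(2) assms(3)[OF c], of w] by (simp add: sum_distrib_right[symmetric])
  qed simp
  finally show ?thesis .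
qed

text \<open>Induction on the rank through a differential inequality in \<open>\<beta>\<close>. Up to
  a multiple of the left side itself, its derivative involves only the codes avoiding one coordinate
  of the support, which have smaller rank and inherit density.\<close>

lemma sum_exp_neg_weight_le:
  fixes w :: "'a \<Rightarrow> real" and d \<beta> :: real
  assumes "finite X" "D \<subseteq> Pow X" "\<And>i. i \<in> X \<Longrightarrow> 0 \<le> w i" "0 \<le> d" "0 \<le> \<beta>"
    and "\<And>V. V \<subseteq> X \<Longrightarrow> d * rk {c \<in> D. c \<subseteq> V} \<le> sum w V"
  shows "(\<Sum>c\<in>D. exp (- \<beta> * sum w c)) \<le> (1 + card X * exp (- \<beta> * d)) ^ rk D"
  using assms(2,5,6)
proof (induction "rk D" arbitrary: D \<beta> rule: less_induct)
  case less
  note fX = assms(1) and w0 = assms(3) and d0 = assms(4)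
  have fin: "finite D" using less.prems fX by (meson finite_Pow_iff finite_subset)
  define U where "U = \<Union>D"
  define W where "W = sum w U"
  define N where "N = real (card X)"
  have U: "U \<subseteq> X" "finite U" using less.prems(1) finite_subset[OF _ fX, of U] unfolding U_def by blast+
  have card: "real (card D) \<le> (1 + N) ^ rk D"
    using of_nat_mono[OF card_le_Suc_card_power_rk[OF fX less.prems(1)], where ?'a=real]
    by (simp add: N_def)
  show ?case
  proof (cases "rk D = 0")
    case True
    then have "D \<subseteq> {{}}" using rk_pos[OF fin] by force
    then have "D = {} \<or> D = {{}}" by auto
    then show ?thesis using True by auto
  next
    case False
    then obtain r where r: "rk D = Suc r" by (cases "rk D") auto
    define Di where "Di i = {c \<in> D. i \<notin> c}" for i
    define Z where "Z b = (\<Sum>c\<in>D. exp (- b * sum w c))" for b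
    define g where "g b = 1 + N * exp (- b * d)" for b
    have g1: "g b \<ge> 1" for b unfolding g_def N_def by simp
    \<comment> \<open>Density at the whole support: the total deletion rate is at least
      \<open>d\<close> times the rank.\<close>
    have Wr: "W \<ge> d * Suc r"
    proof -
      have "{c \<in> D. c \<subseteq> U} = D" unfolding U_def by auto
      then show ?thesis using less.prems(3)[OF U(1)] r W_def by simp
    qed
    have step: "(\<Sum>c\<in>Di i. exp (- b * sum w c)) \<le> g b ^ r" if iU: "i \<in> U" and b0: "b \<ge> 0" for i b
    proof -
      obtain c where c: "c \<in> D" "i \<in> c" using iU unfolding U_def by blast
      have le: "rk (Di i) \<le> r" using rk_contract[OF fin c] r unfolding Di_def by simp
      have "(\<Sum>c\<in>Di i. exp (- b * sum w c)) \<le> (1 + card X * exp (- b * d)) ^ rk (Di i)"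
      proof (rule less.hyps)
        show "rk (Di i) < rk D" using le r by simp
        show "Di i \<subseteq> Pow X" using less.prems Di_def by auto
        fix V assume V: "V \<subseteq> X"
        have "rk {c \<in> Di i. c \<subseteq> V} \<le> rk {c \<in> D. c \<subseteq> V}"
          unfolding Di_def using fin by (intro rk_mono) auto
        then have "d * rk {c \<in> Di i. c \<subseteq> V} \<le> d * rk {c \<in> D. c \<subseteq> V}"
          using d0 by (intro mult_left_mono) auto
        then show "d * rk {c \<in> Di i. c \<subseteq> V} \<le> sum w V" using less.prems(3)[OF V] by linarith
      qed (rule b0)
      also have "\<dots> \<le> g b ^ r" using le g1[of b] unfolding g_def N_def by (intro power_increasing)
      finally show ?thesis .
    qed
    have swap: "(\<Sum>i\<in>U. w i * (\<Sum>c\<in>Di i. exp (- b * sum w c)))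
        = W * Z b - (\<Sum>c\<in>D. sum w c * exp (- b * sum w c))" for b
    proof -
      have "(\<Sum>i\<in>U. w i * (\<Sum>c\<in>Di i. exp (- b * sum w c)))
        = (\<Sum>c\<in>D. (W - sum w c) * exp (- b * sum w c))"
        unfolding Di_def W_def using fin U by (intro sum_weight_sum_avoiding) (auto simp: U_def)
      also have "\<dots> = W * Z b - (\<Sum>c\<in>D. sum w c * exp (- b * sum w c))"
        by (simp add: Z_def left_diff_distrib sum_subtractf sum_distrib_left)
      finally show ?thesis .
    qed
    \<comment> \<open>The claim is \<open>\<psi> \<beta> \<le> 0\<close>; it follows once
      \<open>\<psi>\<close> starts nonpositive and does not increase.\<close>
    define \<psi> where "\<psi> b = exp (W * b) * (Z b - g b ^ Suc r)" for b
    define \<psi>' where "\<psi>' b = exp (W * b) * ((\<Sum>i\<in>U. w i * (\<Sum>c\<in>Di i. exp (- b * sum w c)))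
        + d * Suc r * (g b - 1) * g b ^ r - W * g b ^ Suc r)" for b
    have der: "(\<psi> has_real_derivative \<psi>' b) (at b)" for b
    proof -
      have "(\<psi> has_real_derivative
         (exp (W * b) * W) * (Z b - g b ^ Suc r) + exp (W * b) *
           ((\<Sum>c\<in>D. exp (- b * sum w c) * (- sum w c))
             - (real (Suc r) * g b ^ r) * (N * (exp (- b * d) * (- d))))) (at b)"
        unfolding \<psi>_def Z_def g_def
        by (rule derivative_eq_intros refl | simp)+
      also have "(exp (W * b) * W) * (Z b - g b ^ Suc r) + exp (W * b) *
           ((\<Sum>c\<in>D. exp (- b * sum w c) * (- sum w c))
             - (real (Suc r) * g b ^ r) * (N * (exp (- b * d) * (- d)))) = \<psi>' b"
        unfolding \<psi>'_def swap g_def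
        by (simp add: algebra_simps sum_negf)
      finally show ?thesis .
    qed
    \<comment> \<open>The integrating factor \<open>exp (W * b)\<close> cancels the negative term of the derivative of \<open>Z\<close>,
      leaving only the contracted codes, to which the induction hypothesis applies.\<close>
    have neg: "\<psi>' b \<le> 0" if "b \<ge> 0" for b
    proof -
      have "(\<Sum>i\<in>U. w i * (\<Sum>c\<in>Di i. exp (- b * sum w c))) \<le> (\<Sum>i\<in>U. w i * g b ^ r)"
        using step[OF _ that] w0 U by (intro sum_mono mult_left_mono) auto
      also have "\<dots> = W * g b ^ r" by (simp add: W_def sum_distrib_right)
      finally have "(\<Sum>i\<in>U. w i * (\<Sum>c\<in>Di i. exp (- b * sum w c)))
        + d * Suc r * (g b - 1) * g b ^ r - W * g b ^ Suc r
        \<le> W * g b ^ r + d * Suc r * (g b - 1) * g b ^ r - W * g b ^ Suc r" by simp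
      also have "\<dots> = - ((W - d * Suc r) * ((g b - 1) * g b ^ r))" by (simp add: algebra_simps)
      also have "\<dots> \<le> 0" using Wr g1[of b] by (simp add: mult_nonneg_nonneg)
      finally show ?thesis unfolding \<psi>'_def by (simp add: mult_nonneg_nonpos)
    qed
    have "\<psi> \<beta> \<le> \<psi> 0"
      using less.prems(2) der neg by (intro DERIV_nonpos_imp_nonincreasing[of 0 \<beta> \<psi>]) blast+
    \<comment> \<open>At 0 the generating function counts codewords and \<open>g 0 = 1 + N\<close>,
      so this is the polynomial cardinality bound.\<close>
    also have "\<psi> 0 \<le> 0" unfolding \<psi>_def Z_def g_def using card r by simp
    finally have "Z \<beta> \<le> g \<beta> ^ Suc r" unfolding \<psi>_def by (simp add: mult_le_0_iff)
    then show ?thesis unfolding Z_def g_def N_def using r by simp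
  qed
qed

section \<open>The exponential moment method for signed sums\<close>

section \<open>Signs of small discrepancy\<close>

text \<open>For nonnegative arguments \<open>exp (- (y\<^sup>2 / 2)) * cosh y\<close> is
  nonincreasing: its derivative has the sign of \<open>sinh y - y * cosh y\<close>, which is at most
  0 because \<open>y * cosh y - sinh y\<close> has derivative \<open>y * sinh y\<close>.\<close>

lemma cosh_le_exp_square: "cosh (x::real) \<le> exp (x\<^sup>2 / 2)"
proof -
  have nonneg: "cosh x \<le> exp (x\<^sup>2 / 2)" if "x \<ge> 0" for x :: real
  proof -
    have sinh: "sinh y \<le> y * cosh y" if "y \<ge> 0" for y :: real
    proof -
      have "(\<lambda>y. y * cosh y - sinh y) 0 \<le> (\<lambda>y. y * cosh y - sinh y) y"
      proof (rule DERIV_nonneg_imp_nondecreasing[OF that])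
        fix z :: real assume "0 \<le> z"
        then show "\<exists>D. ((\<lambda>y. y * cosh y - sinh y) has_real_derivative D) (at z) \<and> 0 \<le> D"
          by (intro exI[of _ "z * sinh z"] conjI) (auto intro!: derivative_eq_intros)
      qed
      then show ?thesis by simp
    qed
    have "(\<lambda>y. exp (- (y\<^sup>2 / 2)) * cosh y) x \<le> (\<lambda>y. exp (- (y\<^sup>2 / 2)) * cosh y) 0"
    proof (rule DERIV_nonpos_imp_nonincreasing[OF that])
      fix z :: real assume z: "0 \<le> z"
      have "((\<lambda>y. exp (- (y\<^sup>2 / 2)) * cosh y) has_real_derivative
          exp (- (z\<^sup>2 / 2)) * (sinh z - z * cosh z)) (at z)"
        by (auto intro!: derivative_eq_intros simp: algebra_simps)
      moreover have "exp (- (z\<^sup>2 / 2)) * (sinh z - z * cosh z) \<le> 0"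
        using sinh[OF z] by (intro mult_nonneg_nonpos) auto
      ultimately show "\<exists>D. ((\<lambda>y. exp (- (y\<^sup>2 / 2)) * cosh y) has_real_derivative D) (at z) \<and> D \<le> 0"
        by blast
    qed
    then show ?thesis by (simp add: exp_minus field_simps)
  qed
  show ?thesis using nonneg[of "\<bar>x\<bar>"] by simp
qed

text \<open>Method of conditional expectations. Averaging over one sign multiplies each
  \<open>cosh\<close> by \<open>cosh (v j x)\<close>, a factor that the induction hypothesis absorbs
  into \<open>b\<close>. Since \<open>cosh\<close> is even, both tails are controlled at
  once.\<close>

lemma exists_signs:
  fixes v :: "'b \<Rightarrow> 'a \<Rightarrow> real" and b :: "'b \<Rightarrow> real"
  assumes "finite A" "\<And>j. j \<in> J \<Longrightarrow> 0 \<le> b j"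
  shows "\<exists>\<sigma>. (\<forall>i. \<sigma> i = 1 \<or> \<sigma> i = -1) \<and>
    (\<Sum>j\<in>J. b j * cosh (\<Sum>i\<in>A. \<sigma> i * v j i)) \<le> (\<Sum>j\<in>J. b j * exp ((\<Sum>i\<in>A. (v j i)\<^sup>2) / 2))"
  using assms
proof (induction A arbitrary: b rule: finite_induct)
  case empty
  show ?case by (rule exI[of _ "\<lambda>_. 1"]) simp
next
  case (insert x A)
  obtain \<sigma> :: "'a \<Rightarrow> real" where \<sigma>: "\<And>i. \<sigma> i = 1 \<or> \<sigma> i = -1"
    and le: "(\<Sum>j\<in>J. b j * cosh (v j x) * cosh (\<Sum>i\<in>A. \<sigma> i * v j i))
      \<le> (\<Sum>j\<in>J. b j * cosh (v j x) * exp ((\<Sum>i\<in>A. (v j i)\<^sup>2) / 2))"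
    using insert.IH[of "\<lambda>j. b j * cosh (v j x)"] insert.prems by auto
  define S where "S j = (\<Sum>i\<in>A. \<sigma> i * v j i)" for j
  define F where "F s = (\<Sum>j\<in>J. b j * cosh (S j + s * v j x))" for s
  have "F 1 + F (-1) = 2 * (\<Sum>j\<in>J. b j * cosh (v j x) * cosh (S j))"
    by (simp add: F_def sum.distrib[symmetric] sum_distrib_left cosh_add cosh_diff algebra_simps)
  also have "\<dots> \<le> 2 * (\<Sum>j\<in>J. b j * exp ((\<Sum>i\<in>insert x A. (v j i)\<^sup>2) / 2))"
  proof -
    have "(\<Sum>j\<in>J. b j * cosh (v j x) * cosh (S j))
      \<le> (\<Sum>j\<in>J. b j * cosh (v j x) * exp ((\<Sum>i\<in>A. (v j i)\<^sup>2) / 2))" using le by (simp add: S_def)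
    also have "\<dots> \<le> (\<Sum>j\<in>J. b j * exp ((v j x)\<^sup>2 / 2) * exp ((\<Sum>i\<in>A. (v j i)\<^sup>2) / 2))"
      using insert.prems by (intro sum_mono mult_right_mono mult_left_mono cosh_le_exp_square) auto
    also have "\<dots> = (\<Sum>j\<in>J. b j * exp ((\<Sum>i\<in>insert x A. (v j i)\<^sup>2) / 2))"
      using insert.hyps by (simp add: mult.assoc exp_add[symmetric] add_divide_distrib)
    finally show ?thesis by simp
  qed
  \<comment> \<open>The better of the two signs does at least as well as their average.\<close>
  finally obtain s where s: "s = 1 \<or> s = -1"
    "F s \<le> (\<Sum>j\<in>J. b j * exp ((\<Sum>i\<in>insert x A. (v j i)\<^sup>2) / 2))"
    by (cases "F 1 \<le> F (-1)") (auto intro: that[of 1] that[of "-1"])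
  have "(\<Sum>i\<in>insert x A. (\<sigma>(x := s)) i * v j i) = S j + s * v j x" for j
  proof -
    have "(\<Sum>i\<in>A. (\<sigma>(x := s)) i * v j i) = S j"
      unfolding S_def using insert.hyps by (intro sum.cong) auto
    then show ?thesis using insert.hyps by simp
  qed
  then show ?case using s \<sigma> unfolding F_def by (intro exI[of _ "\<sigma>(x := s)"]) auto
qed

section \<open>Decomposition of the coordinates by density, and signs good on all levels at
  once\<close>

section \<open>Density levels\<close>

lemma sum_nested_differences:
  fixes f :: "'a \<Rightarrow> 'b::comm_monoid_add"
  assumes "finite c" "U 0 = {}" "\<And>t. U t \<subseteq> U (Suc t)"
  shows "(\<Sum>t<T. sum f (c \<inter> (U (Suc t) - U t))) = sum f (c \<inter> U (T::nat))"
proof (induction T)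
  case 0
  then show ?case using assms by simp
next
  case (Suc T)
  have "c \<inter> U (Suc T) = c \<inter> U T \<union> c \<inter> (U (Suc T) - U T)" using assms(3)[of T] by auto
  moreover have "sum f (c \<inter> U T \<union> c \<inter> (U (Suc T) - U T))
      = sum f (c \<inter> U T) + sum f (c \<inter> (U (Suc T) - U T))"
    using assms(1) by (intro sum.union_disjoint) auto
  ultimately show ?case using Suc by simp
qed

text \<open>Each \<open>U (Suc t)\<close> maximises \<open>d * rank - weight\<close> among the
  supersets of \<open>U t\<close>. Maximality against larger sets gives density off
  \<open>U t\<close>; comparison with \<open>U t\<close> itself bounds the weight of the new level
  by its gain in rank.\<close>

lemma exists_levels:
  fixes w :: "'a \<Rightarrow> real"
  assumes X: "finite X" "X \<noteq> {}" and D: "D \<subseteq> Pow X" and w: "\<And>i. i \<in> X \<Longrightarrow> 0 < w i"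
  obtains U :: "nat \<Rightarrow> 'a set" and d0 :: real and T :: nat where
    "0 < d0" "U 0 = {}" "\<And>t. U t \<subseteq> U (Suc t)" "\<And>t. U t \<subseteq> X" "\<And>c. c \<in> D \<Longrightarrow> c \<subseteq> U T"
    "\<And>t V. V \<subseteq> X \<Longrightarrow> d0 * 4 ^ t * rk {e \<in> (\<lambda>c. c - U t) ` D. e \<subseteq> V} \<le> sum w V"
    "\<And>t. sum w (U (Suc t) - U t)
      \<le> d0 * 4 ^ Suc t * (real (rk {c \<in> D. c \<subseteq> U (Suc t)}) - real (rk {c \<in> D. c \<subseteq> U t}))"
proof -
  have finD: "finite D" using X D by (meson finite_Pow_iff finite_subset)
  define R where "R V = real (rk {c \<in> D. c \<subseteq> V})" for V
  define m where "m = Min (w ` X)"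
  have m: "m > 0" "\<And>i. i \<in> X \<Longrightarrow> m \<le> w i" unfolding m_def using X w by auto
  \<comment> \<open>Small enough that \<open>d0 * R V\<close> never exceeds the weight of a nonempty
    \<open>V\<close>; hence the empty set is a maximiser at \<open>t = 0\<close>.\<close>
  define d0 where "d0 = m / (1 + rk D)"
  have d0: "d0 > 0" unfolding d0_def using m by simp
  define \<Phi> where "\<Phi> t V = d0 * 4 ^ t * R V - sum w V" for t :: nat and V
  \<comment> \<open>Optimality among supersets suffices, since density compares \<open>U t\<close>
    only with \<open>V \<union> U t\<close>.\<close>
  define P where "P t V \<longleftrightarrow> V \<subseteq> X \<and> (t = 0 \<longrightarrow> V = {}) \<and> (\<forall>V'. V \<subseteq> V' \<and> V' \<subseteq> X \<longrightarrow> \<Phi> t V' \<le> \<Phi> t V)"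
    for t V
  have "\<exists>U. \<forall>t. P t (U t) \<and> (U t \<subseteq> U (Suc t) \<and> \<Phi> (Suc t) (U t) \<le> \<Phi> (Suc t) (U (Suc t)))"
  proof (rule dependent_nat_choice)
    have "\<Phi> 0 V \<le> \<Phi> 0 {}" if V: "V \<subseteq> X" for V
    proof (cases "V = {}")
      case False
      then obtain i where i: "i \<in> V" by auto
      have "rk {c \<in> D. c \<subseteq> V} \<le> rk D" using finD by (intro rk_mono) auto
      then have "d0 * R V \<le> d0 * (1 + rk D)" using d0 unfolding R_def by (intro mult_left_mono) auto
      also have "\<dots> = m" unfolding d0_def by simp
      also have "m \<le> w i" using m V i by auto
      also have "w i \<le> sum w V"
        using V i w X by (intro member_le_sum) (auto intro: less_imp_le finite_subset)
      finally have "\<Phi> 0 V \<le> 0" unfolding \<Phi>_def by simp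
      also have "0 \<le> \<Phi> 0 {}" unfolding \<Phi>_def R_def using d0 by simp
      finally show ?thesis .
    qed simp
    then show "\<exists>V. P 0 V" unfolding P_def by (intro exI[of _ "{}"]) auto
  next
    fix U t assume U: "P t U"
    define S where "S = {V. U \<subseteq> V \<and> V \<subseteq> X}"
    have S: "finite S" "U \<in> S" unfolding S_def using X U by (auto simp: P_def)
    obtain V where V: "V \<in> S" "\<Phi> (Suc t) V = Max (\<Phi> (Suc t) ` S)"
      using S Max_in[of "\<Phi> (Suc t) ` S"] by (metis empty_iff finite_imageI image_iff image_is_empty)
    have max: "\<Phi> (Suc t) V' \<le> \<Phi> (Suc t) V" if "V' \<in> S" for V' unfolding V using S that by simp
    show "\<exists>V. P (Suc t) V \<and> (U \<subseteq> V \<and> \<Phi> (Suc t) U \<le> \<Phi> (Suc t) V)"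
    proof (intro exI conjI)
      show "P (Suc t) V" unfolding P_def using V(1) max by (auto simp: S_def)
      show "U \<subseteq> V" using V(1) by (simp add: S_def)
    qed (rule max[OF S(2)])
  qed
  then obtain U where P: "\<And>t. P t (U t)" and inc: "\<And>t. U t \<subseteq> U (Suc t)"
    and step: "\<And>t. \<Phi> (Suc t) (U t) \<le> \<Phi> (Suc t) (U (Suc t))" by blast
  have UX: "U t \<subseteq> X" for t using P[of t] by (simp add: P_def)
  have U0: "U 0 = {}" using P[of 0] by (simp add: P_def)
  have dense: "d0 * 4 ^ t * rk {e \<in> (\<lambda>c. c - U t) ` D. e \<subseteq> V} \<le> sum w V" if V: "V \<subseteq> X" for t V
  proof -
    define DV where "DV = {c \<in> D. c \<subseteq> V \<union> U t}"
    have "{c \<in> DV. c \<subseteq> U t} = {c \<in> D. c \<subseteq> U t}"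
      "(\<lambda>c. c - U t) ` DV = {e \<in> (\<lambda>c. c - U t) ` D. e \<subseteq> V}" by (auto simp: DV_def)
    moreover have "finite DV" using finD by (simp add: DV_def)
    ultimately have "real (rk {c \<in> D. c \<subseteq> U t}) + real (rk {e \<in> (\<lambda>c. c - U t) ` D. e \<subseteq> V}) \<le> real (rk DV)"
      using rk_superadditive[of DV "U t"] by (metis of_nat_add of_nat_mono)
    then have "R (U t) + rk {e \<in> (\<lambda>c. c - U t) ` D. e \<subseteq> V} \<le> R (V \<union> U t)"
      by (simp add: R_def DV_def)
    then have "d0 * 4 ^ t * (R (U t) + rk {e \<in> (\<lambda>c. c - U t) ` D. e \<subseteq> V}) \<le> d0 * 4 ^ t * R (V \<union> U t)"
      using d0 by (intro mult_left_mono) auto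
    moreover have "\<Phi> t (V \<union> U t) \<le> \<Phi> t (U t)" using P[of t] V by (auto simp: P_def)
    moreover have "sum w (V \<union> U t) \<le> sum w V + sum w (U t)"
    proof -
      have fin: "finite V" "finite (U t)" using V UX[of t] X finite_subset by blast+
      have "sum w (V \<inter> U t) \<ge> 0" using V w by (intro sum_nonneg) (auto intro: less_imp_le)
      then show ?thesis using sum.union_inter[OF fin, of w] by linarith
    qed
    ultimately show ?thesis unfolding \<Phi>_def by (simp add: algebra_simps)
  qed
  \<comment> \<open>At a scale above the total weight, density forces the projected code to have
    rank 0.\<close>
  obtain T where T: "sum w X / d0 < 4 ^ T" using real_arch_pow[of 4 "sum w X / d0"] by auto
  have all: "c \<subseteq> U T" if c: "c \<in> D" for c
  proof (rule ccontr)
    assume "\<not> c \<subseteq> U T"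
    then have "1 \<le> rk {e \<in> (\<lambda>c. c - U T) ` D. e \<subseteq> X}"
      using finD D c by (intro rk_pos[of _ "c - U T"]) auto
    then have "d0 * 4 ^ T * 1 \<le> d0 * 4 ^ T * rk {e \<in> (\<lambda>c. c - U T) ` D. e \<subseteq> X}"
      using d0 by (intro mult_left_mono) auto
    also have "\<dots> \<le> sum w X" by (rule dense) simp
    also have "\<dots> < d0 * 4 ^ T" using T d0 by (simp add: field_simps)
    finally show False by simp
  qed
  have lev: "sum w (U (Suc t) - U t)
      \<le> d0 * 4 ^ Suc t * (real (rk {c \<in> D. c \<subseteq> U (Suc t)}) - real (rk {c \<in> D. c \<subseteq> U t}))" for t
  proof -
    have "finite (U (Suc t))" using UX X finite_subset by blast
    from sum_diff[OF this inc, of w] show ?thesis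
      using step[of t] unfolding \<Phi>_def R_def right_diff_distrib by simp
  qed
  show ?thesis by (rule that[OF d0 U0 inc UX all dense lev])
qed

text \<open>With \<open>a t\<close> the weight of a codeword on level \<open>t\<close>, only the top \<open>M\<close> levels below \<open>W\<close> count;
  the lower ones form a geometric series.\<close>
lemma sum_sqrt_levels_le:
  fixes a :: "nat \<Rightarrow> real"
  assumes a: "\<And>t. 0 \<le> a t" "\<And>t. a t \<le> 4 * L * (d0 * 4 ^ t)" "\<And>t. a t \<noteq> 0 \<Longrightarrow> d0 * 4 ^ t \<le> W"
    and sum: "(\<Sum>t<T. a t) \<le> W" and d0: "0 < d0" and L: "0 \<le> L" "L \<le> 4 ^ M" and M: "1 \<le> M"
  shows "(\<Sum>t<T. sqrt (a t)) \<le> 5 * sqrt M * sqrt W"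
proof -
  have W: "W \<ge> 0" using sum sum_nonneg[of "{..<T}" a] a(1) by fastforce
  \<comment> \<open>On \<open>Lo\<close> the roots are bounded by a geometric progression of ratio 2
    (hence scales \<open>4 ^ t\<close>), dominated by its largest term. On \<open>Hi\<close> the
    scale lies between \<open>W / L\<close> and \<open>W\<close>, leaving at most \<open>M\<close>
    levels for Cauchy-Schwarz.\<close>
  define Lo where "Lo = {t. t < T \<and> a t \<noteq> 0 \<and> L * (d0 * 4 ^ t) \<le> W}"
  define Hi where "Hi = {t. t < T \<and> a t \<noteq> 0 \<and> W < L * (d0 * 4 ^ t)}"
  have fin: "finite Lo" "finite Hi" unfolding Lo_def Hi_def by auto
  have "(\<Sum>t<T. sqrt (a t)) = (\<Sum>t\<in>Lo \<union> Hi. sqrt (a t))"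
    unfolding Lo_def Hi_def by (intro sum.mono_neutral_right) auto
  also have "\<dots> = (\<Sum>t\<in>Lo. sqrt (a t)) + (\<Sum>t\<in>Hi. sqrt (a t))"
    using fin by (intro sum.union_disjoint) (auto simp: Lo_def Hi_def)
  also have "(\<Sum>t\<in>Lo. sqrt (a t)) \<le> 4 * sqrt W"
  proof (cases "Lo = {}")
    case False
    define \<tau> where "\<tau> = Max Lo"
    have \<tau>: "\<tau> \<in> Lo" "Lo \<subseteq> {..\<tau>}" unfolding \<tau>_def using False fin by auto
    have s4: "sqrt (4 ^ t) = 2 ^ t" for t :: nat
      using real_sqrt_power[of 4 t] by simp
    have "(\<Sum>t\<in>Lo. sqrt (a t)) \<le> (\<Sum>t\<in>Lo. 2 * sqrt (L * d0) * 2 ^ t)"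
    proof (rule sum_mono)
      fix t
      have "sqrt (a t) \<le> sqrt (4 * (L * d0) * 4 ^ t)" using a(2)[of t] by (simp add: mult_ac)
      also have "\<dots> = 2 * sqrt (L * d0) * 2 ^ t" by (simp add: real_sqrt_mult s4)
      finally show "sqrt (a t) \<le> 2 * sqrt (L * d0) * 2 ^ t" .
    qed
    also have "\<dots> \<le> (\<Sum>t\<in>{..\<tau>}. 2 * sqrt (L * d0) * 2 ^ t)"
      using \<tau> L d0 by (intro sum_mono2) auto
    also have "\<dots> = 2 * sqrt (L * d0) * (\<Sum>t\<le>\<tau>. 2 ^ t)" by (simp add: sum_distrib_left)
    also have "(\<Sum>t\<le>\<tau>. (2::real) ^ t) = 2 * 2 ^ \<tau> - 1" by (induction \<tau>) auto
    also have "2 * sqrt (L * d0) * (2 * 2 ^ \<tau> - 1) \<le> 2 * sqrt (L * d0) * (2 * 2 ^ \<tau>)"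
      using L d0 by (intro mult_left_mono) auto
    also have "\<dots> = 4 * sqrt (L * (d0 * 4 ^ \<tau>))" by (simp add: real_sqrt_mult s4)
    also have "\<dots> \<le> 4 * sqrt W" using \<tau>(1) by (simp add: Lo_def)
    finally show ?thesis .
  qed (use W in simp)
  also have "(\<Sum>t\<in>Hi. sqrt (a t)) \<le> sqrt M * sqrt W"
  proof (cases "Hi = {}")
    case False
    define \<tau> where "\<tau> = Min Hi"
    have \<tau>: "\<tau> \<in> Hi" "\<And>t. t \<in> Hi \<Longrightarrow> \<tau> \<le> t" unfolding \<tau>_def using False fin by auto
    have "Hi \<subseteq> {\<tau>..<\<tau> + M}"
    proof
      fix t assume t: "t \<in> Hi"
      have "t < \<tau> + M"
      proof (rule ccontr)
        assume "\<not> t < \<tau> + M"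
        then have "(4::real) ^ M \<le> 4 ^ (t - \<tau>)" by (intro power_increasing) auto
        then have "L \<le> 4 ^ (t - \<tau>)" using L(2) by (rule order_trans[rotated])
        then have "L * (d0 * 4 ^ \<tau>) \<le> 4 ^ (t - \<tau>) * (d0 * 4 ^ \<tau>)"
          using d0 by (intro mult_right_mono) auto
        also have "\<dots> = d0 * 4 ^ t" using \<tau>(2)[OF t] by (simp add: power_add[symmetric] mult_ac)
        also have "\<dots> \<le> W" using t a(3) by (simp add: Hi_def)
        finally show False using \<tau>(1) by (simp add: Hi_def)
      qed
      then show "t \<in> {\<tau>..<\<tau> + M}" using \<tau>(2)[OF t] by simp
    qed
    then have card: "card Hi \<le> M" using card_mono[of "{\<tau>..<\<tau> + M}" Hi] by simp
    have "(\<Sum>t\<in>Hi. sqrt (a t))\<^sup>2 \<le> (\<Sum>t\<in>Hi. (sqrt (a t))\<^sup>2) * card Hi"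
      by (rule sum_squared_le_sum_of_squares)
    also have "\<dots> = card Hi * (\<Sum>t\<in>Hi. a t)" using a(1) by simp
    also have "\<dots> \<le> M * W"
    proof (rule mult_mono)
      have "(\<Sum>t\<in>Hi. a t) \<le> (\<Sum>t<T. a t)" using a(1) by (intro sum_mono2) (auto simp: Hi_def)
      then show "(\<Sum>t\<in>Hi. a t) \<le> W" using sum by simp
    qed (use card a(1) in \<open>auto intro: sum_nonneg\<close>)
    finally have "(\<Sum>t\<in>Hi. sqrt (a t)) \<le> sqrt (M * W)" by (rule real_le_rsqrt)
    then show ?thesis by (simp add: real_sqrt_mult)
  qed (use W in simp)
  also have "4 * sqrt W + sqrt M * sqrt W \<le> 5 * sqrt M * sqrt W"
  proof -
    have "1 * sqrt W \<le> sqrt M * sqrt W" using M W by (intro mult_right_mono) auto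
    then show ?thesis by (simp add: mult_ac)
  qed
  finally show ?thesis by simp
qed

text \<open>A single potential runs over all levels and all projected codewords. The counting lemma
  bounds each level by a constant, so the potential is at most \<open>3 * N\<close>, and each of its
  terms yields one tail bound.\<close>

lemma exists_signs_levels:
  fixes w :: "'a \<Rightarrow> real" and d :: "nat \<Rightarrow> real"
  assumes X: "finite X" "2 \<le> card X" and D: "D \<subseteq> Pow X" and rk: "rk D \<le> card X"
    and w: "\<And>i. i \<in> X \<Longrightarrow> 0 < w i" and d: "\<And>t. 0 < d t" and \<theta>: "0 < \<theta>"
    and U: "U 0 = {}" "\<And>t. U t \<subseteq> U (Suc t)" "\<And>t. U t \<subseteq> X"
    and dense: "\<And>t V. V \<subseteq> X \<Longrightarrow> d t * rk {e \<in> (\<lambda>c. c - U t) ` D. e \<subseteq> V} \<le> sum w V"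
    and A: "A \<subseteq> X" "\<And>t i. i \<in> A \<Longrightarrow> i \<in> U (Suc t) - U t \<Longrightarrow> w i \<le> \<theta> * d t"
  shows "\<exists>\<sigma>. (\<forall>i. \<sigma> i = 1 \<or> \<sigma> i = -1) \<and> (\<forall>t<T. \<forall>c\<in>D.
    \<bar>\<Sum>i\<in>A \<inter> c \<inter> (U (Suc t) - U t). \<sigma> i * w i\<bar>
      \<le> 5 * sqrt (\<theta> * ln (card X)) * sqrt (sum w (c - U t)) * sqrt (sum w (c \<inter> (U (Suc t) - U t))))"
proof -
  define N where "N = real (card X)"
  have N: "N \<ge> 2" unfolding N_def using X by simp
  have lnN: "ln N > 0" using N by simp
  define lev where "lev t = U (Suc t) - U t" for t
  define E where "E t = (\<lambda>c. c - U t) ` D" for t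
  \<comment> \<open>Chosen so that \<open>exp (- \<beta> t * d t) = 1 / N\<^sup>2\<close>; with rank
    at most \<open>N\<close> the counting bound becomes
    \<open>(1 + 1 / N) ^ N \<le> 3\<close>.\<close>
  define \<beta> where "\<beta> t = 2 * ln N / d t" for t
  have \<beta>: "\<beta> t > 0" for t unfolding \<beta>_def using lnN d by simp
  \<comment> \<open>A bound for the sum of squared weights, as light coordinates satisfy
    \<open>w i \<le> \<theta> * d t\<close>.\<close>
  define V where "V t e = \<theta> * d t * sum w (e \<inter> lev t)" for t e
  define s where "s t e = 2 * sqrt (\<beta> t * sum w e / V t e)" for t e
  \<comment> \<open>\<open>T\<close> is not controlled by \<open>N\<close>, but nonempty levels are
    disjoint subsets of \<open>X\<close>, so at most \<open>N\<close> of them occur.\<close>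
  define T' where "T' = {t. t < T \<and> lev t \<noteq> {}}"
  define J where "J = Sigma T' (\<lambda>t. {e \<in> E t. e \<inter> lev t \<noteq> {}})"
  define b where "b = (\<lambda>(t, e). exp (- \<beta> t * sum w e) * exp (- ((s t e)\<^sup>2 * V t e / 2)))"
  define v where "v = (\<lambda>(t, e) i. if i \<in> e \<inter> lev t then s t e * w i else 0)"
  have finA: "finite A" using A X finite_subset by blast
  have finD: "finite D" using X D by (meson finite_Pow_iff finite_subset)
  have EX: "E t \<subseteq> Pow X" for t using D unfolding E_def by auto
  have finE: "finite (E t)" for t using finD unfolding E_def by simp
  have fine: "finite e" "e \<subseteq> X" if "e \<in> E t" for e t using EX that X finite_subset by blast+
  have finJ: "finite J" unfolding J_def T'_def using finE by auto
  have b0: "0 \<le> b j" for j unfolding b_def by (simp add: case_prod_beta)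
  have w_nonneg: "0 \<le> sum w c" if "c \<subseteq> X" for c using that w by (intro sum_nonneg) (auto intro: less_imp_le)
  have V0: "V t e > 0" if "e \<in> E t" "e \<inter> lev t \<noteq> {}" for t e
  proof -
    have "sum w (e \<inter> lev t) > 0" using that fine[OF that(1)] w by (intro sum_pos) auto
    then show ?thesis unfolding V_def using \<theta> d by simp
  qed
  \<comment> \<open>Density at \<open>V = e\<close>: a nonempty projected word has weight at least
    the scale. This later gives \<open>B \<ge> 2 * ln N\<close>.\<close>
  have dist: "d t \<le> sum w e" if "e \<in> E t" "e \<noteq> {}" for t e
  proof -
    have "1 \<le> rk {e' \<in> E t. e' \<subseteq> e}" using that finE by (intro rk_pos[of _ e]) auto
    then have "d t * 1 \<le> d t * rk {e' \<in> E t. e' \<subseteq> e}" using d[of t] by (intro mult_left_mono) auto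
    also have "\<dots> \<le> sum w e" using dense[of e t] fine[OF that(1)] unfolding E_def by auto
    finally show ?thesis by simp
  qed
  obtain \<sigma> :: "'a \<Rightarrow> real" where \<sigma>: "\<forall>i. \<sigma> i = 1 \<or> \<sigma> i = -1"
    and le: "(\<Sum>j\<in>J. b j * cosh (\<Sum>i\<in>A. \<sigma> i * v j i)) \<le> (\<Sum>j\<in>J. b j * exp ((\<Sum>i\<in>A. (v j i)\<^sup>2) / 2))"
    using exists_signs[OF finA, of J b v] b0 by auto
  \<comment> \<open>Up to a constant \<open>s\<close> minimises the tail bound, and \<open>b\<close> turns each term of the potential into
    \<open>exp (- \<beta> t * sum w e)\<close>, which the counting lemma sums over \<open>e\<close>.\<close>
  have potential: "b (t, e) * exp ((\<Sum>i\<in>A. (v (t, e) i)\<^sup>2) / 2) \<le> exp (- \<beta> t * sum w e)"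
    if "(t, e) \<in> J" for t e
  proof -
    have e: "e \<in> E t" using that by (auto simp: J_def)
    have "(\<Sum>i\<in>A. (v (t, e) i)\<^sup>2) = (\<Sum>i\<in>A \<inter> (e \<inter> lev t). (s t e * w i)\<^sup>2)"
      using finA unfolding v_def by (subst sum.inter_restrict) (auto intro: sum.cong)
    also have "\<dots> \<le> (\<Sum>i\<in>A \<inter> (e \<inter> lev t). (s t e)\<^sup>2 * (\<theta> * d t * w i))"
    proof (rule sum_mono)
      fix i assume i: "i \<in> A \<inter> (e \<inter> lev t)"
      then have "w i * w i \<le> \<theta> * d t * w i"
        using A w[of i] by (intro mult_right_mono) (auto simp: lev_def)
      then show "(s t e * w i)\<^sup>2 \<le> (s t e)\<^sup>2 * (\<theta> * d t * w i)"
        by (simp add: power_mult_distrib mult_left_mono power2_eq_square[of "w i"])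
    qed
    also have "\<dots> \<le> (\<Sum>i\<in>e \<inter> lev t. (s t e)\<^sup>2 * (\<theta> * d t * w i))"
    proof (rule sum_mono2)
      fix i assume "i \<in> e \<inter> lev t - A \<inter> (e \<inter> lev t)"
      then have "0 < w i" using fine(2)[OF e] by (intro w) auto
      then show "0 \<le> (s t e)\<^sup>2 * (\<theta> * d t * w i)" using \<theta> d[of t] by simp
    qed (use fine(1)[OF e] in auto)
    also have "\<dots> = (s t e)\<^sup>2 * V t e" unfolding V_def by (simp add: sum_distrib_left mult_ac)
    finally have "exp ((\<Sum>i\<in>A. (v (t, e) i)\<^sup>2) / 2) \<le> exp ((s t e)\<^sup>2 * V t e / 2)" by simp
    then have "b (t, e) * exp ((\<Sum>i\<in>A. (v (t, e) i)\<^sup>2) / 2) \<le> b (t, e) * exp ((s t e)\<^sup>2 * V t e / 2)"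
      by (intro mult_left_mono b0)
    also have "\<dots> = exp (- \<beta> t * sum w e)" unfolding b_def by (simp add: exp_add[symmetric])
    finally show ?thesis .
  qed
  have level: "(\<Sum>e\<in>E t. exp (- \<beta> t * sum w e)) \<le> 3" for t
  proof -
    have "(\<Sum>e\<in>E t. exp (- \<beta> t * sum w e)) \<le> (1 + card X * exp (- \<beta> t * d t)) ^ rk (E t)"
    proof (rule sum_exp_neg_weight_le[OF X(1) EX])
      show "0 \<le> w i" if "i \<in> X" for i using w[OF that] by simp
      show "d t * rk {c \<in> E t. c \<subseteq> V} \<le> sum w V" if "V \<subseteq> X" for V using dense[OF that] unfolding E_def .
    qed (use d[of t] \<beta>[of t] in auto)
    also have "exp (- \<beta> t * d t) = 1 / N\<^sup>2"
    proof -
      have "\<beta> t * d t = ln (N\<^sup>2)" unfolding \<beta>_def using d[of t] N by (simp add: ln_realpow)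
      then show ?thesis using N by (simp add: exp_minus inverse_eq_divide)
    qed
    also have "1 + real (card X) * (1 / N\<^sup>2) = 1 + 1 / N" using N by (simp add: N_def[symmetric] power2_eq_square)
    also have "(1 + 1 / N) ^ rk (E t) \<le> (1 + 1 / N) ^ card X"
    proof (rule power_increasing)
      show "rk (E t) \<le> card X" using rk_diff_le[OF finD, of "U t"] rk unfolding E_def by simp
    qed (use N in auto)
    also have "\<dots> \<le> exp (1 / N) ^ card X" using N by (intro power_mono exp_ge_add_one_self) auto
    also have "\<dots> = exp 1" using N by (simp add: exp_of_nat_mult[symmetric] N_def[symmetric])
    also have "\<dots> \<le> (3::real)" by (rule exp_le)
    finally show ?thesis .
  qed
  have cardT': "real (card T') \<le> N"
  proof -
    have "card T' = (\<Sum>t\<in>T'. 1)" by simp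
    also have "\<dots> \<le> (\<Sum>t\<in>T'. card (X \<inter> lev t))"
    proof (rule sum_mono)
      fix t assume "t \<in> T'"
      then have "X \<inter> lev t \<noteq> {}" using U(3)[of "Suc t"] by (auto simp: T'_def lev_def)
      then show "1 \<le> card (X \<inter> lev t)" using X(1) by (simp add: Suc_leI card_gt_0_iff)
    qed
    also have "\<dots> \<le> (\<Sum>t<T. card (X \<inter> lev t))" by (intro sum_mono2) (auto simp: T'_def)
    also have "\<dots> = card (X \<inter> U T)"
      using sum_nested_differences[OF X(1), of U "\<lambda>_. 1::nat" T] U unfolding lev_def by simp
    also have "\<dots> \<le> card X" using X by (intro card_mono) auto
    finally show ?thesis unfolding N_def by simp
  qed
  have "(\<Sum>j\<in>J. b j * exp ((\<Sum>i\<in>A. (v j i)\<^sup>2) / 2)) \<le> (\<Sum>(t, e)\<in>J. exp (- \<beta> t * sum w e))"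
  proof (rule sum_mono)
    fix j assume "j \<in> J"
    then show "b j * exp ((\<Sum>i\<in>A. (v j i)\<^sup>2) / 2) \<le> (case j of (t, e) \<Rightarrow> exp (- \<beta> t * sum w e))"
      using potential by (cases j) auto
  qed
  also have "\<dots> = (\<Sum>t\<in>T'. \<Sum>e\<in>{e \<in> E t. e \<inter> lev t \<noteq> {}}. exp (- \<beta> t * sum w e))"
    unfolding J_def using finE by (intro sum.Sigma[symmetric]) (auto simp: T'_def)
  also have "\<dots> \<le> (\<Sum>t\<in>T'. \<Sum>e\<in>E t. exp (- \<beta> t * sum w e))"
    using finE by (intro sum_mono sum_mono2) auto
  also have "\<dots> \<le> (\<Sum>t\<in>T'. 3)" using level by (intro sum_mono) auto
  also have "\<dots> \<le> 3 * N" using cardT' by simp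
  finally have total: "(\<Sum>j\<in>J. b j * cosh (\<Sum>i\<in>A. \<sigma> i * v j i)) \<le> 3 * N" using le by simp
  have main: "\<bar>\<Sum>i\<in>A \<inter> (e \<inter> lev t). \<sigma> i * w i\<bar>
      \<le> 5 * sqrt (\<theta> * ln N) * sqrt (sum w e) * sqrt (sum w (e \<inter> lev t))"
    if te: "(t, e) \<in> J" for t e
  proof -
    have e: "e \<in> E t" "e \<inter> lev t \<noteq> {}" using te by (auto simp: J_def)
    define S where "S = (\<Sum>i\<in>A \<inter> (e \<inter> lev t). \<sigma> i * w i)"
    define B where "B = \<beta> t * sum w e"
    have B: "B \<ge> 2 * ln N"
    proof -
      have "\<beta> t * d t \<le> B" unfolding B_def using dist[OF e(1)] e(2) \<beta>[of t] by (intro mult_left_mono) auto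
      then show ?thesis unfolding \<beta>_def using d[of t] by simp
    qed
    have Vp: "V t e > 0" using V0 e .
    have B0: "B > 0" using B lnN by linarith
    have s0: "s t e > 0" unfolding s_def B_def[symmetric] using B0 Vp by simp
    have s2: "(s t e)\<^sup>2 * V t e = 4 * B"
      unfolding s_def B_def[symmetric] using B0 Vp by (simp add: power_mult_distrib)
    have vS: "(\<Sum>i\<in>A. \<sigma> i * v (t, e) i) = s t e * S"
    proof -
      have "(\<Sum>i\<in>A. \<sigma> i * v (t, e) i) = (\<Sum>i\<in>A. if i \<in> e \<inter> lev t then s t e * (\<sigma> i * w i) else 0)"
        unfolding v_def by (intro sum.cong) auto
      also have "\<dots> = (\<Sum>i\<in>A \<inter> (e \<inter> lev t). s t e * (\<sigma> i * w i))"
        using finA by (rule sum.inter_restrict[symmetric])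
      finally show ?thesis by (simp add: S_def sum_distrib_left)
    qed
    have "b (t, e) * cosh (s t e * S) \<le> (\<Sum>j\<in>J. b j * cosh (\<Sum>i\<in>A. \<sigma> i * v j i))"
      using member_le_sum[OF te, of "\<lambda>j. b j * cosh (\<Sum>i\<in>A. \<sigma> i * v j i)"] finJ b0 vS by simp
    also note total
    \<comment> \<open>One \<open>B\<close> comes from the counting weight and \<open>2 * B\<close>
      from \<open>(s t e)\<^sup>2 * V t e / 2\<close>.\<close>
    also have "b (t, e) = exp (- (3 * B))"
      unfolding b_def using s2 by (simp add: B_def[symmetric] exp_add[symmetric])
    finally have c: "cosh (s t e * S) \<le> 3 * N * exp (3 * B)" by (simp add: exp_minus field_simps)
    have "exp (s t e * \<bar>S\<bar>) \<le> 2 * cosh (s t e * \<bar>S\<bar>)" by (simp add: cosh_field_def)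
    also have "cosh (s t e * \<bar>S\<bar>) = cosh (s t e * S)"
      using s0 cosh_real_abs[of "s t e * S"] by (simp add: abs_mult)
    also have "2 * cosh (s t e * S) \<le> 6 * N * exp (3 * B)" using c by simp
    \<comment> \<open>The price of summing over all levels is at most \<open>exp (4 * ln N)\<close>,
      hence at most \<open>exp (2 * B)\<close>.\<close>
    also have "6 * N \<le> N ^ 4"
    proof -
      have "2 ^ 3 \<le> N ^ 3" using N by (intro power_mono) auto
      then have "6 * N \<le> N ^ 3 * N" using N by (intro mult_right_mono) auto
      then show ?thesis by (simp add: eval_nat_numeral)
    qed
    also have "N ^ 4 = exp (4 * ln N)" using N by (simp add: exp_of_nat_mult[of 4, simplified])
    also have "exp (4 * ln N) * exp (3 * B) \<le> exp (5 * B)"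
      using B by (simp add: exp_add[symmetric])
    finally have sS: "s t e * \<bar>S\<bar> \<le> 5 * B" by simp
    have sq: "s t e = 2 * sqrt B / sqrt (V t e)"
      unfolding s_def B_def by (simp add: real_sqrt_divide)
    have "\<bar>S\<bar> \<le> 5 * B / s t e" using sS s0 by (simp add: field_simps)
    also have "\<dots> = 5 / 2 * (B / sqrt B) * sqrt (V t e)" unfolding sq by simp
    also have "\<dots> = 5 / 2 * sqrt (B * V t e)" using B0 by (simp add: real_div_sqrt real_sqrt_mult)
    also have "B * V t e = 2 * (\<theta> * ln N * sum w e * sum w (e \<inter> lev t))"
      unfolding B_def V_def \<beta>_def using d[of t] by simp
    also have "5 / 2 * sqrt (2 * (\<theta> * ln N * sum w e * sum w (e \<inter> lev t)))
        \<le> 5 / 2 * (2 * sqrt (\<theta> * ln N * sum w e * sum w (e \<inter> lev t)))"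
    proof -
      have "sqrt 2 \<le> (2::real)" by (rule real_le_lsqrt) auto
      moreover have "0 \<le> \<theta> * ln N * sum w e * sum w (e \<inter> lev t)"
        using \<theta> lnN w_nonneg[of e] w_nonneg[of "e \<inter> lev t"] fine[OF e(1)]
        by (intro mult_nonneg_nonneg) auto
      ultimately show ?thesis unfolding real_sqrt_mult[of 2] by (intro mult_left_mono mult_right_mono) auto
    qed
    finally show ?thesis unfolding S_def by (simp add: real_sqrt_mult)
  qed
  have "\<bar>\<Sum>i\<in>A \<inter> c \<inter> lev t. \<sigma> i * w i\<bar>
      \<le> 5 * sqrt (\<theta> * ln N) * sqrt (sum w (c - U t)) * sqrt (sum w (c \<inter> lev t))"
    if t: "t < T" and c: "c \<in> D" for t c
  proof (cases "c \<inter> lev t = {}")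
    case True
    then have "A \<inter> c \<inter> lev t = {}" by auto
    then show ?thesis using True by simp
  next
    case False
    have eq: "(c - U t) \<inter> lev t = c \<inter> lev t" by (auto simp: lev_def)
    have "(t, c - U t) \<in> J" unfolding J_def T'_def E_def using t c False eq by auto
    from main[OF this] show ?thesis unfolding eq by (simp add: Int_assoc)
  qed
  then show ?thesis using \<sigma> unfolding lev_def N_def by blast
qed

section \<open>One halving step and its relative error\<close>

section \<open>Halving the support\<close>

text \<open>At most \<open>N / 2\<close> coordinates are too heavy for their level and are kept. The
  others are doubled or deleted, at most half of them surviving, so the support shrinks to at most
  \<open>3 / 4\<close> of its size; the signed sum is the error.\<close>

lemma exists_halving_positive:
  fixes w :: "'a \<Rightarrow> real"
  assumes X: "finite X" "2 \<le> card X" and D: "D \<subseteq> Pow X" and w: "\<And>i. i \<in> X \<Longrightarrow> 0 < w i"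
    and L: "rk D \<le> L" "1 \<le> L" "L \<le> card X" "L \<le> 4 ^ M" and M: "1 \<le> M"
  shows "\<exists>w'. (\<forall>i\<in>X. 0 \<le> w' i) \<and> real (card {i \<in> X. w' i \<noteq> 0}) \<le> 3 / 4 * card X \<and>
    (\<forall>c\<in>D. \<bar>sum w' c - sum w c\<bar> \<le> 75 * sqrt (real L * real M * ln (card X) / card X) * sum w c)"
proof -
  define N where "N = real (card X)"
  have N: "N \<ge> 2" unfolding N_def using X by simp
  have lnN: "ln N > 0" using N by simp
  have "X \<noteq> {}" using X by auto
  obtain U :: "nat \<Rightarrow> 'a set" and d0 :: real and T where d0: "0 < d0"
    and U: "U 0 = {}" "\<And>t. U t \<subseteq> U (Suc t)" "\<And>t. U t \<subseteq> X" and UT: "\<And>c. c \<in> D \<Longrightarrow> c \<subseteq> U T"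
    and dense: "\<And>t V. V \<subseteq> X \<Longrightarrow> d0 * 4 ^ t * rk {e \<in> (\<lambda>c. c - U t) ` D. e \<subseteq> V} \<le> sum w V"
    and light: "\<And>t. sum w (U (Suc t) - U t)
      \<le> d0 * 4 ^ Suc t * (real (rk {c \<in> D. c \<subseteq> U (Suc t)}) - real (rk {c \<in> D. c \<subseteq> U t}))"
    by (rule exists_levels[OF X(1) \<open>X \<noteq> {}\<close> D w]) (assumption | rule that)+
  have finD: "finite D" using X D by (meson finite_Pow_iff finite_subset)
  define d where "d t = d0 * 4 ^ t" for t :: nat
  have d: "d t > 0" for t unfolding d_def using d0 by simp
  define lev where "lev t = U (Suc t) - U t" for t
  have lev: "lev t \<subseteq> X" "finite (lev t)" for t
    using U(3)[of "Suc t"] X finite_subset[of "lev t" X] unfolding lev_def by blast+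
  define R where "R t = real (rk {c \<in> D. c \<subseteq> U t})" for t
  have R: "R t \<le> L" for t
    using rk_mono[OF finD, of "{c \<in> D. c \<subseteq> U t}"] L(1) unfolding R_def by auto
  have R_nonneg: "0 \<le> R t" for t by (simp add: R_def)
  have w_lev: "sum w (lev t) \<le> 4 * d t * (R (Suc t) - R t)" for t
    using light[of t] by (simp add: lev_def d_def R_def mult_ac)
  \<comment> \<open>Makes the bound \<open>4 * L / \<theta>\<close> on the number of heavy
    coordinates equal to \<open>N / 2\<close>.\<close>
  define \<theta> where "\<theta> = 8 * L / N"
  have \<theta>: "\<theta> > 0" unfolding \<theta>_def using L N by simp
  define I where "I = (\<Union>t<T. {i \<in> lev t. \<theta> * d t < w i})"
  define A where "A = (X \<inter> U T) - I"
  have A: "A \<subseteq> X" "finite A" unfolding A_def using X by auto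
  have I: "I \<subseteq> X" "finite I" using lev X finite_subset[of I X] unfolding I_def by blast+
  have cardI: "real (card I) \<le> N / 2"
  proof -
    have "card I \<le> (\<Sum>t<T. card {i \<in> lev t. \<theta> * d t < w i})"
      unfolding I_def by (rule card_UN_le) simp
    then have "real (card I) \<le> (\<Sum>t<T. real (card {i \<in> lev t. \<theta> * d t < w i}))"
      unfolding of_nat_sum[symmetric] of_nat_le_iff .
    also have "\<dots> \<le> (\<Sum>t<T. 4 / \<theta> * (R (Suc t) - R t))"
    \<comment> \<open>Markov's inequality on each level; the rank increments then telescope to at
      most \<open>L\<close>.\<close>
    proof (rule sum_mono)
      fix t
      have "\<theta> * d t * card {i \<in> lev t. \<theta> * d t < w i} = (\<Sum>i\<in>{i \<in> lev t. \<theta> * d t < w i}. \<theta> * d t)"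
        by simp
      also have "\<dots> \<le> (\<Sum>i\<in>{i \<in> lev t. \<theta> * d t < w i}. w i)" by (intro sum_mono) auto
      also have "\<dots> \<le> sum w (lev t)"
      proof (rule sum_mono2)
        show "0 \<le> w i" if "i \<in> lev t - {i \<in> lev t. \<theta> * d t < w i}" for i
          using w[of i] lev(1)[of t] that by fastforce
      qed (use lev in auto)
      also note w_lev
      finally have "d t * (\<theta> * card {i \<in> lev t. \<theta> * d t < w i}) \<le> d t * (4 * (R (Suc t) - R t))"
        by (simp only: mult_ac)
      then have "\<theta> * card {i \<in> lev t. \<theta> * d t < w i} \<le> 4 * (R (Suc t) - R t)"
        using d[of t] by (rule mult_left_le_imp_le)
      then show "real (card {i \<in> lev t. \<theta> * d t < w i}) \<le> 4 / \<theta> * (R (Suc t) - R t)"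
        using \<theta> by (simp add: field_simps)
    qed
    also have "\<dots> = 4 / \<theta> * (R T - R 0)"
      by (simp only: sum_distrib_left[symmetric] sum_lessThan_telescope)
    also have "\<dots> \<le> 4 / \<theta> * L" using R[of T] R_nonneg[of 0] \<theta> by (intro mult_left_mono) auto
    also have "\<dots> = N / 2" unfolding \<theta>_def using L N by simp
    finally show ?thesis .
  qed
  have light_A: "w i \<le> \<theta> * d t" if i: "i \<in> A" "i \<in> U (Suc t) - U t" for i t
  proof -
    have mono: "U a \<subseteq> U b" if "a \<le> b" for a b using that U(2) by (rule lift_Suc_mono_le[rotated])
    have "t < T"
    proof (rule ccontr)
      assume "\<not> t < T"
      then show False using mono[of T t] i by (auto simp: A_def)
    qed
    then show ?thesis using i by (force simp: A_def I_def lev_def)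
  qed
  have "rk D \<le> card X" using L by simp
  from exists_signs_levels[OF X D this w d \<theta> U dense[folded d_def] A(1) light_A, of T]
  obtain \<sigma> :: "'a \<Rightarrow> real"
    where \<sigma>: "\<And>i. \<sigma> i = 1 \<or> \<sigma> i = -1" and dev: "\<And>t c. t < T \<Longrightarrow> c \<in> D \<Longrightarrow>
      \<bar>\<Sum>i\<in>A \<inter> c \<inter> lev t. \<sigma> i * w i\<bar>
        \<le> 5 * sqrt (\<theta> * ln N) * sqrt (sum w (c - U t)) * sqrt (sum w (c \<inter> lev t))"
    unfolding lev_def N_def by blast
  have err: "\<bar>\<Sum>i\<in>A \<inter> c. \<sigma> i * w i\<bar> \<le> 75 * sqrt (real L * real M * ln N / N) * sum w c" if c: "c \<in> D" for c
  proof -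
    have cX: "c \<subseteq> X" "finite c" using c D X finite_subset by blast+
    define W where "W = sum w c"
    define a where "a t = sum w (c \<inter> lev t)" for t
    have w0: "0 \<le> w i" if "i \<in> c" for i using w[of i] that cX by auto
    have W0: "W \<ge> 0" unfolding W_def using w0 by (intro sum_nonneg)
    have le_W: "sum w c' \<le> W" if "c' \<subseteq> c" for c'
      unfolding W_def using that cX w0 by (intro sum_mono2) auto
    have a0: "a t \<ge> 0" for t unfolding a_def using w0 by (intro sum_nonneg) auto
    have "A \<inter> c \<inter> U T = A \<inter> c" by (auto simp: A_def)
    then have "(\<Sum>i\<in>A \<inter> c. \<sigma> i * w i) = (\<Sum>t<T. \<Sum>i\<in>A \<inter> c \<inter> lev t. \<sigma> i * w i)"
      using sum_nested_differences[of "A \<inter> c" U "\<lambda>i. \<sigma> i * w i" T] A U unfolding lev_def by simp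
    also have "\<bar>\<dots>\<bar> \<le> (\<Sum>t<T. \<bar>\<Sum>i\<in>A \<inter> c \<inter> lev t. \<sigma> i * w i\<bar>)" by (rule sum_abs)
    also have "\<dots> \<le> (\<Sum>t<T. 5 * sqrt (\<theta> * ln N) * sqrt W * sqrt (a t))"
    proof (rule sum_mono)
      fix t assume "t \<in> {..<T}"
      then have "\<bar>\<Sum>i\<in>A \<inter> c \<inter> lev t. \<sigma> i * w i\<bar>
        \<le> 5 * sqrt (\<theta> * ln N) * sqrt (sum w (c - U t)) * sqrt (a t)"
        using dev[OF _ c] unfolding a_def by simp
      also have "\<dots> \<le> 5 * sqrt (\<theta> * ln N) * sqrt W * sqrt (a t)"
        using le_W[of "c - U t"] a0[of t] \<theta> lnN by (intro mult_right_mono mult_left_mono) auto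
      finally show "\<bar>\<Sum>i\<in>A \<inter> c \<inter> lev t. \<sigma> i * w i\<bar> \<le> 5 * sqrt (\<theta> * ln N) * sqrt W * sqrt (a t)" .
    qed
    also have "\<dots> = 5 * sqrt (\<theta> * ln N) * sqrt W * (\<Sum>t<T. sqrt (a t))"
      by (simp add: sum_distrib_left)
    also have "(\<Sum>t<T. sqrt (a t)) \<le> 5 * sqrt M * sqrt W"
    proof (rule sum_sqrt_levels_le[OF a0 _ _ _ d0 _ _ M])
      show "a t \<le> 4 * real L * (d0 * 4 ^ t)" for t
      proof -
        have "a t \<le> sum w (lev t)" unfolding a_def
          using lev[of t] w by (intro sum_mono2) (auto intro: less_imp_le)
        also have "\<dots> \<le> 4 * d t * (R (Suc t) - R t)" by (rule w_lev)
        also have "\<dots> \<le> 4 * d t * L" using d[of t] R[of "Suc t"] R_nonneg[of t] by (intro mult_left_mono) auto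
        finally show ?thesis by (simp add: d_def mult_ac)
      qed
      show "d0 * 4 ^ t \<le> W" if "a t \<noteq> 0" for t
      proof -
        have ne: "c - U t \<noteq> {}"
        proof
          assume "c - U t = {}"
          then have "c \<inter> lev t = {}" by (auto simp: lev_def)
          then show False using that by (simp add: a_def)
        qed
        have "1 \<le> rk {e \<in> (\<lambda>c. c - U t) ` D. e \<subseteq> c - U t}"
          using finD c ne by (intro rk_pos[of _ "c - U t"]) auto
        then have "d0 * 4 ^ t * 1 \<le> d0 * 4 ^ t * rk {e \<in> (\<lambda>c. c - U t) ` D. e \<subseteq> c - U t}"
          using d0 by (intro mult_left_mono) auto
        also have "\<dots> \<le> sum w (c - U t)" using cX by (intro dense) auto
        also have "\<dots> \<le> W" by (rule le_W) auto
        finally show ?thesis by simp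
      qed
      have "(\<Sum>t<T. a t) = sum w (c \<inter> U T)"
        unfolding a_def lev_def using sum_nested_differences[of c U w T] cX U by simp
      then show "(\<Sum>t<T. a t) \<le> W" using le_W[of "c \<inter> U T"] by simp
      show "real L \<le> 4 ^ M" using L(4) by (metis of_nat_le_iff of_nat_numeral of_nat_power)
    qed simp
    also have "5 * sqrt (\<theta> * ln N) * sqrt W * (5 * sqrt M * sqrt W) = 25 * sqrt (\<theta> * ln N * M) * W"
      using W0 by (simp add: real_sqrt_mult)
    \<comment> \<open>The constant 75 is 25 times the bound 3 for \<open>sqrt 8\<close>.\<close>
    also have "\<theta> * ln N * M = 8 * (real L * real M * ln N / N)" unfolding \<theta>_def by simp
    also have "sqrt (8 * (real L * real M * ln N / N)) \<le> 3 * sqrt (real L * real M * ln N / N)"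
    proof -
      have "sqrt 8 \<le> (3::real)" by (rule real_le_lsqrt) auto
      then show ?thesis unfolding real_sqrt_mult[of 8]
        using lnN N by (intro mult_right_mono) (auto intro!: real_sqrt_ge_zero mult_nonneg_nonneg)
    qed
    finally show ?thesis using W0 \<theta> lnN unfolding W_def[symmetric]
      by (simp add: mult_left_mono mult_right_mono)
  qed
  \<comment> \<open>A global sign change leaves the absolute discrepancy unchanged and makes the
    doubled coordinates the minority.\<close>
  obtain s :: real where s: "s = 1 \<or> s = -1" "2 * card {i \<in> A. s * \<sigma> i = 1} \<le> card A"
  proof -
    have "A = {i \<in> A. \<sigma> i = 1} \<union> {i \<in> A. - \<sigma> i = 1}" using \<sigma> by force
    then have "card A = card {i \<in> A. \<sigma> i = 1} + card {i \<in> A. - \<sigma> i = 1}"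
      using A by (metis (mono_tags, lifting) card_Un_disjoint disjoint_iff finite_Un mem_Collect_eq
          neg_equal_iff_equal one_neq_neg_one)
    then show ?thesis using that[of 1] that[of "-1"]
      by (cases "card {i \<in> A. \<sigma> i = 1} \<le> card {i \<in> A. - \<sigma> i = 1}") auto
  qed
  define w' where "w' i = (if i \<in> A then (1 + s * \<sigma> i) * w i else if i \<in> I then w i else 0)" for i
  have s\<sigma>: "s * \<sigma> i = 1 \<or> s * \<sigma> i = -1" for i using s(1) \<sigma>[of i] by auto
  show ?thesis
  proof (intro exI[of _ w'] conjI ballI)
    fix i assume "i \<in> X"
    then show "0 \<le> w' i" using w[of i] s\<sigma>[of i] unfolding w'_def by auto
  next
    have "{i \<in> X. w' i \<noteq> 0} \<subseteq> I \<union> {i \<in> A. s * \<sigma> i = 1}"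
    proof
      fix i assume "i \<in> {i \<in> X. w' i \<noteq> 0}"
      then show "i \<in> I \<union> {i \<in> A. s * \<sigma> i = 1}"
        using s\<sigma>[of i] unfolding w'_def by (auto split: if_splits)
    qed
    then have "card {i \<in> X. w' i \<noteq> 0} \<le> card (I \<union> {i \<in> A. s * \<sigma> i = 1})"
      using I A by (intro card_mono) auto
    also have "\<dots> \<le> card I + card {i \<in> A. s * \<sigma> i = 1}" by (rule card_Un_le)
    finally have "2 * real (card {i \<in> X. w' i \<noteq> 0}) \<le> 2 * real (card I) + real (card A)"
      using s(2) by linarith
    moreover have "card I + card A = card (I \<union> A)"
      using I A by (intro card_Un_disjoint[symmetric]) (auto simp: A_def)
    moreover have "card (I \<union> A) \<le> card X" using I A X by (intro card_mono) auto
    ultimately show "real (card {i \<in> X. w' i \<noteq> 0}) \<le> 3 / 4 * card X"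
      using cardI unfolding N_def by linarith
  next
    fix c assume c: "c \<in> D"
    have fc: "finite c" "c \<subseteq> X" using c D X finite_subset by blast+
    have "sum w' c - sum w c = (\<Sum>i\<in>c. if i \<in> A then s * (\<sigma> i * w i) else 0)"
      unfolding sum_subtractf[symmetric] using UT[OF c] fc
      by (intro sum.cong) (auto simp: w'_def A_def algebra_simps)
    also have "\<dots> = s * (\<Sum>i\<in>A \<inter> c. \<sigma> i * w i)"
      using fc by (simp add: sum.inter_restrict[symmetric] sum_distrib_left Int_commute)
    finally have "\<bar>sum w' c - sum w c\<bar> = \<bar>\<Sum>i\<in>A \<inter> c. \<sigma> i * w i\<bar>" using s(1) by auto
    then show "\<bar>sum w' c - sum w c\<bar> \<le> 75 * sqrt (real L * real M * ln (card X) / card X) * sum w c"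
      using err[OF c] unfolding N_def by simp
  qed
qed

text \<open>Removes positivity of the weights: coordinates of weight zero are projected away, which
  does not raise the rank, and the new weights are extended by 0.\<close>

lemma exists_halving:
  fixes w :: "'a \<Rightarrow> real"
  assumes Y: "finite Y" "D \<subseteq> Pow Y" and w: "\<And>i. i \<in> Y \<Longrightarrow> 0 \<le> w i"
    and N: "N = card {i \<in> Y. w i \<noteq> 0}" "2 \<le> N" "L \<le> N"
    and L: "rk D \<le> L" "1 \<le> L" "L \<le> 4 ^ M" and M: "1 \<le> M"
  obtains w' where "\<And>i. i \<in> Y \<Longrightarrow> 0 \<le> w' i" "real (card {i \<in> Y. w' i \<noteq> 0}) \<le> 3 / 4 * N"
    "\<And>c. c \<in> D \<Longrightarrow> \<bar>sum w' c - sum w c\<bar> \<le> 75 * sqrt (real L * real M * ln N / N) * sum w c"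
proof -
  define X where "X = {i \<in> Y. w i \<noteq> 0}"
  define D' where "D' = (\<lambda>c. c - (Y - X)) ` D"
  have X: "finite X" "D' \<subseteq> Pow X" using Y unfolding X_def D'_def by auto
  have "finite D" using Y by (meson finite_Pow_iff finite_subset)
  then have rk: "rk D' \<le> L" using rk_diff_le[of D "Y - X"] L unfolding D'_def by simp
  have "\<exists>w'. (\<forall>i\<in>X. 0 \<le> w' i) \<and> real (card {i \<in> X. w' i \<noteq> 0}) \<le> 3 / 4 * card X \<and>
    (\<forall>c\<in>D'. \<bar>sum w' c - sum w c\<bar> \<le> 75 * sqrt (real L * real M * ln (card X) / card X) * sum w c)"
    using X rk L M N w unfolding X_def[symmetric]
    by (intro exists_halving_positive) (auto simp: X_def order_less_le)
  then obtain w' where w': "\<forall>i\<in>X. 0 \<le> w' i" "real (card {i \<in> X. w' i \<noteq> 0}) \<le> 3 / 4 * N"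
    "\<forall>c\<in>D'. \<bar>sum w' c - sum w c\<bar> \<le> 75 * sqrt (real L * real M * ln N / N) * sum w c"
    unfolding N(1) X_def by blast
  define w'' where "w'' i = (if i \<in> X then w' i else 0)" for i
  show ?thesis
  proof (rule that[of w''])
    show "0 \<le> w'' i" for i using w'(1) by (simp add: w''_def)
    have "{i \<in> Y. w'' i \<noteq> 0} = {i \<in> X. w' i \<noteq> 0}" by (auto simp: w''_def X_def)
    then show "real (card {i \<in> Y. w'' i \<noteq> 0}) \<le> 3 / 4 * N" using w'(2) by simp
    fix c assume c: "c \<in> D"
    have fc: "finite c" using c Y finite_subset by blast
    have "sum w'' c = sum w' (c - (Y - X))"
      unfolding w''_def using fc c Y
      by (intro sum.mono_neutral_cong_right) auto
    moreover have "sum w c = sum w (c - (Y - X))"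
      using fc c Y by (intro sum.mono_neutral_right) (auto simp: X_def)
    ultimately show "\<bar>sum w'' c - sum w c\<bar> \<le> 75 * sqrt (real L * real M * ln N / N) * sum w c"
      using w'(3) c by (simp add: D'_def)
  qed
qed

section \<open>Geometric iteration and the choice of constants\<close>

section \<open>Iteration\<close>

text \<open>Strong induction on the support size, with an error budget depending on that size;
  halving stops at size \<open>S\<close>. The hypothesis \<open>slack\<close> concerns twice the
  step error because relative errors compound.\<close>

lemma exists_sparsifier_of_halving:
  fixes w :: "'a \<Rightarrow> real" and \<epsilon> S :: real
  assumes Y: "finite Y" "D \<subseteq> Pow Y" and w: "\<And>i. i \<in> Y \<Longrightarrow> 0 \<le> w i"
    and L: "rk D \<le> L" "1 \<le> L" "L \<le> 4 ^ M" and M: "1 \<le> M"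
    and \<epsilon>: "0 < \<epsilon>" "\<epsilon> < 1" and S: "2 \<le> S" "L \<le> S"
    and slack: "\<And>N. S \<le> N \<Longrightarrow> 150 * sqrt (real L * real M * ln N / N) \<le> 35 / 1000 * \<epsilon> * sqrt (sqrt (S / N))"
  shows "\<exists>w'. (\<forall>i\<in>Y. 0 \<le> w' i) \<and> card {i \<in> Y. w' i \<noteq> 0} \<le> S \<and>
    (\<forall>c\<in>D. \<bar>sum w' c - sum w c\<bar> \<le> \<epsilon> * sum w c)"
proof -
  \<comment> \<open>The support shrinks by a factor 3/4 per step and (4/3)^(1/4) > 1.07, so the bound \<open>\<delta>\<close> drops by at
    least 0.035 \<open>\<epsilon> (S/N)^(1/4)\<close>, which \<open>slack\<close> makes room for the error of the step.\<close>
  define \<delta> where "\<delta> N = (if N \<le> S then 0 else \<epsilon> * (1 - 1 / 2 * sqrt (sqrt (S / N))))" for N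
  have \<delta>_le: "\<delta> N \<le> \<epsilon>" for N
    using \<epsilon> S by (auto simp: \<delta>_def intro!: mult_left_le)
  have "\<exists>w'. (\<forall>i\<in>Y. 0 \<le> w' i) \<and> card {i \<in> Y. w' i \<noteq> 0} \<le> S \<and>
      (\<forall>c\<in>D. \<bar>sum w' c - sum w c\<bar> \<le> \<delta> (real N) * sum w c)"
    if "N = card {i \<in> Y. w i \<noteq> 0}" "\<And>i. i \<in> Y \<Longrightarrow> 0 \<le> w i" for N w
    using that
  proof (induction N arbitrary: w rule: less_induct)
    case (less N)
    show ?case
    proof (cases "real N \<le> S")
      case True
      then show ?thesis using less.prems by (intro exI[of _ w]) (auto simp: \<delta>_def)
    next
      case False
      define q where "q = sqrt (sqrt (S / N))"
      define \<eta> where "\<eta> = 75 * sqrt (real L * real M * ln N / N)"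
      have N: "real N > S" "2 \<le> N" "L \<le> N" using False S by auto
      have q: "0 < q" "q \<le> 1" unfolding q_def using S N by auto
      have \<eta>: "2 * \<eta> \<le> 35 / 1000 * \<epsilon> * q" using slack[of N] N unfolding \<eta>_def q_def by simp
      have \<eta>0: "0 \<le> \<eta>" unfolding \<eta>_def using N by simp
      obtain w1 where w1: "\<And>i. i \<in> Y \<Longrightarrow> 0 \<le> w1 i" "real (card {i \<in> Y. w1 i \<noteq> 0}) \<le> 3 / 4 * N"
        and e1: "\<And>c. c \<in> D \<Longrightarrow> \<bar>sum w1 c - sum w c\<bar> \<le> \<eta> * sum w c"
        using exists_halving[OF Y less.prems(2,1) N(2,3) L M] unfolding \<eta>_def by blast
      define N1 where "N1 = card {i \<in> Y. w1 i \<noteq> 0}"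
      have "N1 < N" using w1(2) N unfolding N1_def by linarith
      from less.IH[OF this N1_def w1(1)] obtain w2 where
        w2: "\<forall>i\<in>Y. 0 \<le> w2 i" "card {i \<in> Y. w2 i \<noteq> 0} \<le> S"
        and e2: "\<And>c. c \<in> D \<Longrightarrow> \<bar>sum w2 c - sum w1 c\<bar> \<le> \<delta> (real N1) * sum w1 c" by blast
      \<comment> \<open>\<open>535 / 1000\<close> is half of \<open>107 / 100\<close>, so
        \<open>\<delta>1\<close> bounds the budget left at the smaller support; adding
        \<open>35 / 1000 * \<epsilon> * q\<close> gives back the coefficient
        \<open>1 / 2\<close>.\<close>
      define \<delta>1 where "\<delta>1 = \<epsilon> * (1 - 535 / 1000 * q)"
      have \<delta>1: "0 \<le> \<delta>1" "\<delta>1 \<le> 1" unfolding \<delta>1_def using \<epsilon> q by (auto intro!: mult_le_one)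
      have "\<delta> (real N1) \<le> \<delta>1"
      proof (cases "real N1 \<le> S")
        case True
        then show ?thesis using \<delta>1 by (simp add: \<delta>_def)
      next
        case N1: False
        have "(107 / 100) ^ 4 * (S / N) \<le> 4 / 3 * (S / N)" using S N by (intro mult_right_mono) (auto simp: eval_nat_numeral)
        also have "\<dots> \<le> S / N1" using w1(2) S N1 N unfolding N1_def[symmetric] by (simp add: field_simps)
        finally have "sqrt (sqrt ((107 / 100) ^ 4 * (S / N))) \<le> sqrt (sqrt (S / N1))" by simp
        also have "sqrt (sqrt ((107 / 100) ^ 4 * (S / N))) = 107 / 100 * q"
        proof -
          have "sqrt ((107 / 100) ^ 4) = (107 / 100 :: real)\<^sup>2"
            by (rule real_sqrt_unique) (auto simp: power_mult[symmetric])
          then have "sqrt (sqrt ((107 / 100) ^ 4)) = (107 / 100 :: real)" by simp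
          then show ?thesis unfolding real_sqrt_mult q_def by simp
        qed
        finally have "535 / 1000 * q \<le> 1 / 2 * sqrt (sqrt (S / N1))" by simp
        then show ?thesis using N1 \<epsilon> unfolding \<delta>_def \<delta>1_def by (auto intro!: mult_left_mono)
      qed
      have "\<bar>sum w2 c - sum w c\<bar> \<le> \<delta> (real N) * sum w c" if c: "c \<in> D" for c
      proof -
        define W where "W = sum w c"
        have W: "W \<ge> 0" unfolding W_def using c Y less.prems(2) by (intro sum_nonneg) auto
        have W1: "sum w1 c \<ge> 0" using c Y w1(1) by (intro sum_nonneg) auto
        have a: "\<bar>sum w1 c - W\<bar> \<le> \<eta> * W" using e1[OF c] by (simp add: W_def)
        then have "sum w1 c \<le> W + \<eta> * W" by linarith
        then have "\<delta>1 * sum w1 c \<le> \<delta>1 * (W + \<eta> * W)" using \<delta>1(1) by (rule mult_left_mono)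
        moreover have "\<delta> (real N1) * sum w1 c \<le> \<delta>1 * sum w1 c"
          using \<open>\<delta> (real N1) \<le> \<delta>1\<close> W1 by (rule mult_right_mono)
        \<comment> \<open>The step error enters directly and again through the later error relative
          to \<open>w1\<close>; \<open>\<delta>1 \<le> 1\<close> makes this
          \<open>2 * \<eta>\<close>.\<close>
        moreover have "\<delta>1 * (\<eta> * W) \<le> 1 * (\<eta> * W)" using \<delta>1 \<eta>0 W by (intro mult_right_mono) auto
        ultimately have "\<bar>sum w2 c - W\<bar> \<le> \<delta>1 * W + 2 * \<eta> * W"
          using a e2[OF c] by (simp add: distrib_left)
        also have "\<dots> = (\<delta>1 + 2 * \<eta>) * W" by (simp add: distrib_right)
        also have "\<delta>1 + 2 * \<eta> \<le> \<delta> (real N)"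
          using \<eta> False unfolding \<delta>1_def \<delta>_def q_def[symmetric] by (simp add: algebra_simps)
        finally show ?thesis using W by (simp add: W_def mult_right_mono)
      qed
      then show ?thesis using w2 by blast
    qed
  qed
  from this[where w = w, OF refl w] obtain w' where w': "\<forall>i\<in>Y. 0 \<le> w' i" "card {i \<in> Y. w' i \<noteq> 0} \<le> S"
    and e: "\<And>c. c \<in> D \<Longrightarrow> \<bar>sum w' c - sum w c\<bar> \<le> \<delta> (real (card {i \<in> Y. w i \<noteq> 0})) * sum w c" by blast
  have "\<bar>sum w' c - sum w c\<bar> \<le> \<epsilon> * sum w c" if c: "c \<in> D" for c
  proof -
    have "sum w c \<ge> 0" using c Y w by (intro sum_nonneg) auto
    then show ?thesis using e[OF c] mult_right_mono[OF \<delta>_le] by (meson order_trans)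
  qed
  then show ?thesis using w' by blast
qed

text \<open>With \<open>y = N / S\<close>, \<open>ln N\<close> is at most a constant times
  \<open>\<Lambda> * sqrt y\<close>, so dividing by \<open>N\<close> still leaves a decay of
  \<open>1 / sqrt y\<close>. The outer root turns it into the required fourth root of
  \<open>S / N\<close>.\<close>

lemma halving_slack:
  fixes \<epsilon> \<Lambda> L M N :: real
  assumes \<epsilon>: "0 < \<epsilon>" "\<epsilon> < 1" and L: "1 \<le> L" and \<Lambda>: "\<Lambda> = lg (L / \<epsilon>)"
    and M: "0 \<le> M" "M \<le> 2 * \<Lambda>" and S: "S = 10 ^ 18 * L * \<Lambda>\<^sup>2 / \<epsilon>\<^sup>2" and N: "S \<le> N"
  shows "150 * sqrt (L * M * ln N / N) \<le> 35 / 1000 * \<epsilon> * sqrt (sqrt (S / N))"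
proof -
  have \<Lambda>1: "\<Lambda> \<ge> 1" unfolding \<Lambda> lg_def by simp
  have x1: "L / \<epsilon> \<ge> 1" using \<epsilon> L by simp
  have S0: "S > 0" unfolding S using L \<epsilon> \<Lambda>1 by simp
  define y where "y = N / S"
  have y: "y \<ge> 1" "N = S * y" unfolding y_def using S0 N by auto
  have ln_sqrt: "ln z \<le> 2 * sqrt z" if "z > 0" for z :: real
  proof -
    have "ln z = 2 * ln (sqrt z)" using that by (simp add: ln_sqrt)
    also have "ln (sqrt z) \<le> sqrt z - 1" using that by (intro ln_le_minus_one) simp
    finally show ?thesis by simp
  qed
  have sy: "sqrt y \<ge> 1" using y by simp
  have "ln N = ln (10 ^ 18) + ln L + 2 * ln \<Lambda> - 2 * ln \<epsilon> + ln y"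
    unfolding y(2) S using L \<epsilon> \<Lambda>1 y by (simp add: ln_mult ln_div ln_realpow)
  also have "ln (10 ^ 18 :: real) \<le> 2 * 10 ^ 9"
  proof -
    have "sqrt (10 ^ 18) = (10 ^ 9 :: real)" by (rule real_sqrt_unique) auto
    then show ?thesis using ln_sqrt[of "10 ^ 18"] by simp
  qed
  also have "ln \<Lambda> \<le> \<Lambda>" using ln_le_minus_one[of \<Lambda>] \<Lambda>1 by simp
  also have "ln y \<le> 2 * sqrt y" using y by (intro ln_sqrt) simp
  \<comment> \<open>From \<open>ln L - ln \<epsilon> \<le> \<Lambda>\<close>, doubled, with
    \<open>ln L \<ge> 0\<close>; this form cancels the term
    \<open>- 2 * ln \<epsilon>\<close>.\<close>
  also have "ln L \<le> 2 * \<Lambda> + 2 * ln \<epsilon>"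
  proof -
    have "ln (L / \<epsilon>) \<le> log 2 (L / \<epsilon>)"
    proof -
      have "ln (L / \<epsilon>) * ln 2 \<le> ln (L / \<epsilon>) * 1"
        using x1 ln_le_minus_one[of "2::real"] by (intro mult_left_mono) auto
      then show ?thesis by (simp add: log_def field_simps)
    qed
    also have "\<dots> \<le> \<Lambda>" by (simp add: \<Lambda> lg_def)
    finally have "ln L - ln \<epsilon> \<le> \<Lambda>" using L \<epsilon> by (simp add: ln_div)
    moreover have "ln L \<ge> 0" using L by simp
    ultimately show ?thesis by linarith
  qed
  finally have "ln N \<le> 2 * 10 ^ 9 + 4 * \<Lambda> + 2 * sqrt y" by simp
  also have "\<dots> \<le> 3 * 10 ^ 9 * (\<Lambda> * sqrt y)"
  proof -
    have "1 * 1 \<le> \<Lambda> * sqrt y" "\<Lambda> * 1 \<le> \<Lambda> * sqrt y" "1 * sqrt y \<le> \<Lambda> * sqrt y"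
      using \<Lambda>1 sy by (intro mult_mono; simp)+
    then show ?thesis by simp
  qed
  finally have lnN: "ln N \<le> 3 * 10 ^ 9 * (\<Lambda> * sqrt y)" .
  have "L * M * ln N \<le> L * (2 * \<Lambda>) * (3 * 10 ^ 9 * (\<Lambda> * sqrt y))"
  proof (rule mult_mono)
    show "0 \<le> ln N"
    proof -
      have "1 * 1 * 1 \<le> 10 ^ 18 * L * \<Lambda>\<^sup>2" using L \<Lambda>1 by (intro mult_mono) auto
      moreover have "\<epsilon>\<^sup>2 \<le> 1" using \<epsilon> by (simp add: power_le_one)
      ultimately have "S \<ge> 1" unfolding S using \<epsilon> by simp
      then show ?thesis using N by simp
    qed
  qed (use L M \<Lambda>1 lnN in \<open>auto intro!: mult_left_mono\<close>)
  also have "\<dots> = 6 * 10 ^ 9 * (\<epsilon>\<^sup>2 * S / 10 ^ 18) * sqrt y"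
    unfolding S using \<epsilon> by (simp add: power2_eq_square)
  finally have "L * M * ln N / N \<le> 6 * 10 ^ 9 * (\<epsilon>\<^sup>2 * S / 10 ^ 18) * sqrt y / N"
    using N S0 by (intro divide_right_mono) auto
  also have "\<dots> = 6 / 10 ^ 9 * \<epsilon>\<^sup>2 * (sqrt y / y)"
    unfolding y(2) using S0 y(1) by simp
  also have "sqrt y / y = sqrt (S / N)"
    using y(1) S0 unfolding y(2) by (simp add: sqrt_divide_self_eq real_sqrt_divide inverse_eq_divide)
  \<comment> \<open>The factor \<open>10 ^ 18\<close> in \<open>S\<close> pays for the crude
    \<open>3 * 10 ^ 9\<close> in the bound on \<open>ln N\<close>; at the end
    \<open>150 / 10 ^ 4\<close> is below \<open>35 / 1000\<close>.\<close>
  also have "6 / 10 ^ 9 * \<epsilon>\<^sup>2 * sqrt (S / N) \<le> (1 / 10 ^ 4)\<^sup>2 * \<epsilon>\<^sup>2 * sqrt (S / N)"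
    using N S0 by (intro mult_right_mono) (auto simp: eval_nat_numeral)
  finally have "sqrt (L * M * ln N / N) \<le> sqrt ((1 / 10 ^ 4)\<^sup>2 * \<epsilon>\<^sup>2 * sqrt (S / N))" by simp
  also have "\<dots> = 1 / 10 ^ 4 * \<epsilon> * sqrt (sqrt (S / N))"
    using \<epsilon> by (simp add: real_sqrt_mult)
  finally have "150 * sqrt (L * M * ln N / N) \<le> 150 / 10 ^ 4 * (\<epsilon> * sqrt (sqrt (S / N)))" by simp
  also have "\<dots> \<le> 35 / 1000 * (\<epsilon> * sqrt (sqrt (S / N)))"
    using \<epsilon> N S0 by (intro mult_right_mono) auto
  finally show ?thesis by simp
qed

theorem mainTheorem1:
  shows "\<exists>K::real. \<forall>(m::nat) (C::nat set set) (w::nat \<Rightarrow> real) (\<epsilon>::real).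
     is_code m C \<longrightarrow> chain_length m C \<ge> 1 \<longrightarrow>
     (\<forall>i\<in>{1..m}. w i \<ge> 0) \<longrightarrow> 0 < \<epsilon> \<longrightarrow> \<epsilon> < 1 \<longrightarrow>
     (\<exists>w'. is_sparsifier m C w \<epsilon> w' \<and>
        real (card (supp_m m w')) \<le>
          K * real (chain_length m C) * (lg (real (chain_length m C) / \<epsilon>))^2
            * (lg (lg (real (chain_length m C) / \<epsilon>)))^2 / \<epsilon>^2)"
proof (intro exI[of _ "10 ^ 18"] allI impI)
  fix m :: nat and C :: "nat set set" and w :: "nat \<Rightarrow> real" and \<epsilon> :: real
  assume C: "is_code m C" and L: "chain_length m C \<ge> 1" and w: "\<forall>i\<in>{1..m}. w i \<ge> 0"
    and \<epsilon>: "0 < \<epsilon>" "\<epsilon> < 1"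
  define L where "L = chain_length m C"
  define \<Lambda> where "\<Lambda> = lg (real L / \<epsilon>)"
  \<comment> \<open>An upper bound for the binary logarithm of \<open>L / \<epsilon>\<close>, hence
    \<open>L \<le> 4 ^ M\<close>; rounding up costs at most a factor 2.\<close>
  define M where "M = nat \<lceil>\<Lambda>\<rceil>"
  define S where "S = 10 ^ 18 * real L * \<Lambda>\<^sup>2 / \<epsilon>\<^sup>2"
  have L1: "1 \<le> L" using L by (simp add: L_def)
  have \<Lambda>1: "\<Lambda> \<ge> 1" unfolding \<Lambda>_def lg_def by simp
  have M: "\<Lambda> \<le> real M" "real M \<le> 2 * \<Lambda>" "1 \<le> M"
    unfolding M_def using \<Lambda>1 by linarith+
  have LM: "L \<le> 4 ^ M"
  proof -
    have "real L \<le> L / \<epsilon>" using \<epsilon> L1 by (simp add: field_simps)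
    also have "\<dots> = 2 powr (log 2 (L / \<epsilon>))" using \<epsilon> L1 by simp
    also have "\<dots> \<le> 2 powr (real M)" using M(1) by (simp add: \<Lambda>_def lg_def)
    also have "\<dots> = 2 ^ M" by (simp add: powr_realpow)
    also have "\<dots> \<le> 4 ^ M" by (intro power_mono) auto
    finally show ?thesis by (metis of_nat_le_iff of_nat_numeral of_nat_power)
  qed
  have LS: "10 ^ 18 * real L \<le> S"
  proof -
    have "10 ^ 18 * real L * 1 \<le> 10 ^ 18 * real L * (\<Lambda>\<^sup>2 / \<epsilon>\<^sup>2)"
    proof (rule mult_left_mono)
      have "\<epsilon>\<^sup>2 \<le> 1" "1 \<le> \<Lambda>\<^sup>2" using \<epsilon> \<Lambda>1 by (auto simp: power_le_one)
      then show "1 \<le> \<Lambda>\<^sup>2 / \<epsilon>\<^sup>2" using \<epsilon> by simp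
    qed simp
    then show ?thesis by (simp add: S_def)
  qed
  have "2 * real L \<le> 10 ^ 18 * real L" by (intro mult_right_mono) auto
  then have S2: "2 \<le> S" "real L \<le> S" using LS L1 by linarith+
  have "\<exists>w'. (\<forall>i\<in>{1..m}. 0 \<le> w' i) \<and> card {i \<in> {1..m}. w' i \<noteq> 0} \<le> S \<and>
    (\<forall>c\<in>C. \<bar>sum w' c - sum w c\<bar> \<le> \<epsilon> * sum w c)"
  proof (rule exists_sparsifier_of_halving)
    show "C \<subseteq> Pow {1..m}" using C by (auto simp: is_code_def)
    show "rk C \<le> L" unfolding L_def by (rule rk_le_chain_length[OF C])
    show "150 * sqrt (real L * real M * ln N / N) \<le> 35 / 1000 * \<epsilon> * sqrt (sqrt (S / N))" if "S \<le> N" for N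
      using L1 M by (intro halving_slack[OF \<epsilon> _ \<Lambda>_def _ _ S_def that]) auto
  qed (use w L1 LM M \<epsilon> S2 in auto)
  then obtain w' where w': "\<forall>i\<in>{1..m}. 0 \<le> w' i" "card {i \<in> {1..m}. w' i \<noteq> 0} \<le> S"
    "\<forall>c\<in>C. \<bar>sum w' c - sum w c\<bar> \<le> \<epsilon> * sum w c" by blast
  have "is_sparsifier m C w \<epsilon> w'"
    unfolding is_sparsifier_def code_weight_def
  proof (intro conjI ballI)
    fix c assume "c \<in> C"
    then have "\<bar>sum w' c - sum w c\<bar> \<le> \<epsilon> * sum w c" using w' by blast
    then show "(1 - \<epsilon>) * sum w c \<le> sum w' c" "sum w' c \<le> (1 + \<epsilon>) * sum w c"
      unfolding left_diff_distrib distrib_right by linarith+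
  qed (use w' in auto)
  \<comment> \<open>The support has size at most \<open>S\<close>, and the iterated logarithm is at
    least 1 by the convention in \<open>lg\<close>.\<close>
  moreover have "real (card (supp_m m w')) \<le> 10 ^ 18 * real L * \<Lambda>\<^sup>2 * (lg \<Lambda>)\<^sup>2 / \<epsilon>\<^sup>2"
  proof -
    have "1 \<le> lg \<Lambda>" by (simp add: lg_def)
    then have "1 \<le> (lg \<Lambda>)\<^sup>2" by simp
    then have "S * 1 \<le> S * (lg \<Lambda>)\<^sup>2" using S2 by (intro mult_left_mono) auto
    then show ?thesis using w'(2) by (simp add: supp_m_def S_def mult_ac)
  qed
  ultimately show "\<exists>w'. is_sparsifier m C w \<epsilon> w' \<and>
        real (card (supp_m m w')) \<le>
          10 ^ 18 * real (chain_length m C) * (lg (real (chain_length m C) / \<epsilon>))^2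
            * (lg (lg (real (chain_length m C) / \<epsilon>)))^2 / \<epsilon>^2"
    unfolding L_def \<Lambda>_def by blast
qed

end
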